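(* Let $(X^n)_n$ be a sequence of càdlàg processes, $(\mathcal{F}^n)_n$ their natural filtrations, $X$ a càdlàg process and $\mathcal{F}$ the right-continuous filtration associated to its natural filtration. Let $\gamma:[0,T]\times\mathbb{R}\to\mathbb{R}$ be bounded and continuous. Suppose that $X^n\to X$ in probability (for the Skorokhod topology), that Aldous' criterion for tightness holds, i.e. $$\forall \varepsilon>0,\quad \lim_{\delta\downarrow 0}\ \limsup_{n\to+\infty}\ \sup_{\sigma,\nu\in\mathcal{T}^n_T,\ \sigma\leqslant\nu\leqslant\sigma+\delta}\ \mathbb{P}\big[|X^n_\sigma-X^n_\nu|\geqslant\varepsilon\big]=0,$$ and that $\mathcal{F}^n\xrightarrow{w}\mathcal{F}$ (weak convergence of filtrations). Then $$\limsup_{n\to\infty}\Gamma_n(T)\leqslant\Gamma(T),$$ where $\Gamma(T)=\sup_{\tau\in\mathcal{T}_T}\mathbb{E}[\gamma(\tau,X_\tau)]$ and $\Gamma_n(T)=\sup_{\tau\in\mathcal{T}^n_T}\mathbb{E}[\gamma(\tau,X^n_\tau)]$.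
   Context: $(\Omega,\mathcal{A},\mathbb{P})$ is a probability space on which all processes are defined, $T>0$ is fixed, all processes are real-valued and indexed by $[0,T]$, and all filtrations are indexed by $[0,T]$. $\mathbb{D}([0,T])$ is the space of càdlàg functions $[0,T]\to\mathbb{R}$ with the Skorokhod ($J_1$) topology; convergence in probability of càdlàg processes is for this topology. The natural filtration of a process $Y$ is $\mathcal{F}^Y_t=\sigma(Y_s,\,s\leqslant t)$. The right-continuous filtration associated to the natural filtration of $X$ is $\mathcal{F}_t=\mathcal{F}^X_{t^+}=\bigcap_{s>t}\mathcal{F}^X_s$ for $t<T$, with $\mathcal{F}_T=\mathcal{F}^X_T$. $\mathcal{T}_T$ (resp. $\mathcal{T}^n_T$) is the set of $\mathcal{F}$-stopping times (resp. $\mathcal{F}^n$-stopping times) bounded by $T$. Weak convergence of filtrations $\mathcal{F}^n\xrightarrow{w}\mathcal{F}$ means: for every $A\in\mathcal{F}_T$, the sequence of processes $(\mathbb{E}[1_A|\mathcal{F}^n_\cdot])_n$ converges in probability to $\mathbb{E}[1_A|\mathcal{F}_\cdot]$ for the Skorokhod topology. *)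

theory Defs
  imports "HOL-Probability.Probability"
begin

definition cadlag :: "real \<Rightarrow> (real \<Rightarrow> real) \<Rightarrow> bool" where
  "cadlag T f \<longleftrightarrow>
     (\<forall>t\<in>{0..<T}. (f \<longlongrightarrow> f t) (at_right t)) \<and>
     (\<forall>t\<in>{0<..T}. \<exists>l. (f \<longlongrightarrow> l) (at_left t))"

(* Processes are functions on all of real; only the values at times in {0..T} matter. *)
definition cadlag_process :: "'a measure \<Rightarrow> real \<Rightarrow> (real \<Rightarrow> 'a \<Rightarrow> real) \<Rightarrow> bool" where
  "cadlag_process M T X \<longleftrightarrow>
     (\<forall>t\<in>{0..T}. X t \<in> borel_measurable M) \<and>
     (\<forall>\<omega>\<in>space M. cadlag T (\<lambda>t. X t \<omega>))"

definition time_changes :: "real \<Rightarrow> (real \<Rightarrow> real) set" where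
  "time_changes T =
     {l. continuous_on {0..T} l \<and> strict_mono_on {0..T} l \<and> l ` {0..T} = {0..T}}"

(* The standard metric of the J1 topology, with values in ennreal so that the suprema
   make sense for arbitrary functions; it is finite on cadlag functions. *)
definition skorokhod_dist :: "real \<Rightarrow> (real \<Rightarrow> real) \<Rightarrow> (real \<Rightarrow> real) \<Rightarrow> ennreal" where
  "skorokhod_dist T f g =
     (INF l\<in>time_changes T.
        max (SUP t\<in>{0..T}. ennreal \<bar>l t - t\<bar>)
            (SUP t\<in>{0..T}. ennreal \<bar>f t - g (l t)\<bar>))"

(* For cadlag processes the sets below are events, because the Borel sets of the Skorokhod
   space are generated by the evaluations.  Outer probability then
   is the probability; it is used so that the definition does not rest on this fact
   (measure and emeasure are 0 on non-measurable sets). *)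
definition skorokhod_conv_in_prob ::
  "'a measure \<Rightarrow> real \<Rightarrow> (nat \<Rightarrow> real \<Rightarrow> 'a \<Rightarrow> real) \<Rightarrow> (real \<Rightarrow> 'a \<Rightarrow> real) \<Rightarrow> bool" where
  "skorokhod_conv_in_prob M T Y Z \<longleftrightarrow>
     (\<forall>\<epsilon>>0. (\<lambda>n. outer_measure_of M
        {\<omega>\<in>space M. skorokhod_dist T (\<lambda>t. Y n t \<omega>) (\<lambda>t. Z t \<omega>) \<ge> ennreal \<epsilon>})
      \<longlonglongrightarrow> 0)"

definition natural_filtration ::
  "'a measure \<Rightarrow> (real \<Rightarrow> 'a \<Rightarrow> real) \<Rightarrow> real \<Rightarrow> 'a measure" where
  "natural_filtration M Y t =
     sigma (space M) {Y s -` B \<inter> space M | s B. s \<in> {0..t} \<and> B \<in> sets borel}"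

definition right_cont_filtration ::
  "'a measure \<Rightarrow> real \<Rightarrow> (real \<Rightarrow> 'a \<Rightarrow> real) \<Rightarrow> real \<Rightarrow> 'a measure" where
  "right_cont_filtration M T X t =
     (if t < T then sigma (space M) (\<Inter>s\<in>{t<..T}. sets (natural_filtration M X s))
      else natural_filtration M X T)"

lemma space_natural_filtration [simp]: "space (natural_filtration M Y t) = space M"
  unfolding natural_filtration_def by (rule space_measure_of) auto

lemma sets_right_cont_filtration:
  assumes "t < T"
  shows "sets (right_cont_filtration M T X t) =
           (\<Inter>s\<in>{t<..T}. sets (natural_filtration M X s))"
proof -
  let ?S = "\<Inter>s\<in>{t<..T}. sets (natural_filtration M X s)"
  have sub: "?S \<subseteq> Pow (space M)"
  proof
    fix A assume "A \<in> ?S"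
    then have "A \<in> sets (natural_filtration M X T)" using assms by auto
    then show "A \<in> Pow (space M)" using sets.sets_into_space by fastforce
  qed
  have "sigma_algebra (space M) ?S"
    unfolding sigma_algebra_iff2
  proof (intro conjI ballI allI impI)
    show "?S \<subseteq> Pow (space M)" by (rule sub)
    show "{} \<in> ?S" by auto
    show "space M - A \<in> ?S" if "A \<in> ?S" for A
      using that sets.compl_sets[of A "natural_filtration M X _"] by auto
    show "(\<Union>i. A i) \<in> ?S" if "range A \<subseteq> ?S" for A :: "nat \<Rightarrow> 'a set"
      using that by (auto intro!: sets.countable_nat_UN)
  qed
  then show ?thesis
    using assms sub by (simp add: right_cont_filtration_def sigma_algebra.sigma_sets_eq)
qed

(* The library's stopping_time quantifies over all real times; for \<tau> with values in {0..T}
   the times outside {0..T} impose no condition. *)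
definition stopping_times ::
  "'a measure \<Rightarrow> real \<Rightarrow> (real \<Rightarrow> 'a measure) \<Rightarrow> ('a \<Rightarrow> real) set" where
  "stopping_times M T F = {\<tau>. stopping_time F \<tau> \<and> (\<forall>\<omega>\<in>space M. \<tau> \<omega> \<in> {0..T})}"

(* E[1_A | F_t] is determined only almost surely for each t, so the process is any of its
   cadlag versions; these are indistinguishable from each other. *)
definition cadlag_cond_prob ::
  "'a measure \<Rightarrow> real \<Rightarrow> (real \<Rightarrow> 'a measure) \<Rightarrow> 'a set \<Rightarrow> (real \<Rightarrow> 'a \<Rightarrow> real) \<Rightarrow> bool" where
  "cadlag_cond_prob M T F A Z \<longleftrightarrow>
     cadlag_process M T Z \<and>
     (\<forall>t\<in>{0..T}. AE \<omega> in M. Z t \<omega> = real_cond_exp M (F t) (indicator A) \<omega>)"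

definition weak_filtration_conv ::
  "'a measure \<Rightarrow> real \<Rightarrow> (nat \<Rightarrow> real \<Rightarrow> 'a measure) \<Rightarrow> (real \<Rightarrow> 'a measure) \<Rightarrow> bool" where
  "weak_filtration_conv M T Fn F \<longleftrightarrow>
     (\<forall>A\<in>sets (F T). \<exists>Zn Z.
        (\<forall>n. cadlag_cond_prob M T (Fn n) A (Zn n)) \<and>
        cadlag_cond_prob M T F A Z \<and>
        skorokhod_conv_in_prob M T Zn Z)"

definition aldous_criterion ::
  "'a measure \<Rightarrow> real \<Rightarrow> (nat \<Rightarrow> real \<Rightarrow> 'a measure) \<Rightarrow> (nat \<Rightarrow> real \<Rightarrow> 'a \<Rightarrow> real) \<Rightarrow> bool" where
  "aldous_criterion M T Fn Xn \<longleftrightarrow>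
     (\<forall>\<epsilon>>0. ((\<lambda>\<delta>. limsup (\<lambda>n.
        SUP (\<sigma>, \<nu>) \<in> {(\<sigma>, \<nu>). \<sigma> \<in> stopping_times M T (Fn n) \<and> \<nu> \<in> stopping_times M T (Fn n) \<and>
                         (\<forall>\<omega>\<in>space M. \<sigma> \<omega> \<le> \<nu> \<omega> \<and> \<nu> \<omega> \<le> \<sigma> \<omega> + \<delta>)}.
          emeasure M {\<omega>\<in>space M. \<bar>Xn n (\<sigma> \<omega>) \<omega> - Xn n (\<nu> \<omega>) \<omega>\<bar> \<ge> \<epsilon>}))
      \<longlongrightarrow> 0) (at_right 0))"

definition optimal_value ::
  "'a measure \<Rightarrow> real \<Rightarrow> (real \<Rightarrow> 'a measure) \<Rightarrow> (real \<times> real \<Rightarrow> real) \<Rightarrow> (real \<Rightarrow> 'a \<Rightarrow> real) \<Rightarrow> real" where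
  "optimal_value M T F \<gamma> X =
     (SUP \<tau>\<in>stopping_times M T F. \<integral>\<omega>. \<gamma> (\<tau> \<omega>, X (\<tau> \<omega>) \<omega>) \<partial>M)"

end

theory Submission
  imports Defs
begin

text \<open>
  The value of an optimal stopping problem has an upper bound by martingale duality, and this
  bound passes to the limit because weak convergence of filtrations makes every
  \<open>\<F>\<close>-martingale increment after a time \<open>s\<close> asymptotically orthogonal to \<open>\<F>\<^sup>n\<^sub>s\<close>.

  Reduction to finitely many times.  Round an \<open>\<F>\<^sup>n\<close>-stopping time \<open>\<tau>\<close> up to a point \<open>\<rho>\<close> of the grid
  \<open>jT/k\<close>, but look at \<open>X\<^sup>n\<close> slightly later, at \<open>\<rho> + h\<close>.  By Aldous' criterion \<open>X\<^sup>n\<close> moves little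
  between \<open>\<tau>\<close> and \<open>\<rho> + h\<close>, uniformly in \<open>\<tau>\<close>, if \<open>T/k + h\<close> is small.  At a fixed grid point \<open>s\<close>, a
  time change that displaces times by less than \<open>h\<close> maps \<open>s + h\<close> into the interval from \<open>s\<close> to
  \<open>s + 2h\<close>, on which \<open>X\<close> is close to \<open>X\<^sub>s\<close> by right-continuity; so \<open>X\<^sup>n\<close> at \<open>s + h\<close> is close to \<open>X\<^sub>s\<close>
  in probability (\<open>skorokhod_conv_lagged\<close>).  Thanks to the lag, \<open>X\<close> may jump at grid points.  Hence
  \<open>E[\<gamma>(\<tau>, X\<^sup>n\<^sub>\<tau>)]\<close> is at most \<open>E[\<gamma>(\<rho>, X\<^sub>\<rho>)]\<close> up to a small error
  (\<open>stopped_reward_le_grid\<close>).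

  The discrete problem.  The time \<open>\<rho>\<close> is a stopping time for \<open>\<F>\<^sup>n\<close>, not for \<open>\<F>\<close>.  Let \<open>U\<close> be the
  Snell envelope of the grid rewards \<open>Y\<^sub>j\<close> with respect to \<open>\<F>\<close>, with martingale increments
  \<open>D\<^sub>i = U\<^sub>i\<^sub>+\<^sub>1 - E[U\<^sub>i\<^sub>+\<^sub>1 | \<F>]\<close>, conditioned at the \<open>i\<close>-th grid time.  The Doob decomposition gives
  \<open>Y\<^sub>j \<le> U\<^sub>0 + \<Sum>i<j. D\<^sub>i\<close> pointwise, and \<open>E[U\<^sub>0] \<le> \<Gamma>(T)\<close> because \<open>E[U\<^sub>0]\<close> is the expected reward of an
  \<open>\<F>\<close>-stopping time (\<open>snell_envelope\<close>).  So \<open>E[Y\<^sub>\<rho>]\<close> exceeds \<open>\<Gamma>(T)\<close> by at most the sum of the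
  integrals of the \<open>D\<^sub>i\<close> over the events that \<open>\<rho>\<close> is later than the \<open>i\<close>-th grid time, and these
  events belong to \<open>\<F>\<^sup>n\<close> at the \<open>i\<close>-th grid time (\<open>discrete_optimal_value_bound\<close>).

  Orthogonality.  It remains to see that \<open>E[1\<^sub>B (D - E[D | \<F>\<^sub>s])]\<close> tends to \<open>0\<close> uniformly over the
  events \<open>B\<close> of \<open>\<F>\<^sup>n\<^sub>s\<close> (\<open>weak_filtration_conv_integrable\<close>).  For \<open>D = 1\<^sub>A\<close>, such a \<open>B\<close> also belongs to
  \<open>\<F>\<^sup>n\<close> at time \<open>s + h\<close>, so \<open>1\<^sub>A\<close> may be replaced by its conditional expectation given \<open>\<F>\<^sup>n\<close> at time
  \<open>s + h\<close>, and the lag argument, applied to the convergent processes \<open>P(A | \<F>\<^sup>n)\<close>, shows that this is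
  close to \<open>P(A | \<F>\<^sub>s)\<close>.
\<close>

section \<open>Right-continuous paths\<close>

text \<open>
  One-sided limits bound the path on both sides of every time, and \<open>{0..T}\<close> is compact.
\<close>

lemma cadlag_imp_bounded:
  assumes "cadlag T f"
  shows "bounded (f ` {0..T})"
proof -
  have bdd_near_limit: "bounded (f ` S)" if "\<And>x. x \<in> S \<Longrightarrow> dist (f x) l < 1" for S l
    using that by (intro bounded_subset[OF bounded_ball[of l 1]]) (auto simp: dist_commute)
  have local: "\<exists>U. open U \<and> t \<in> U \<and> bounded (f ` (U \<inter> {0..T}))" if t: "t \<in> {0..T}" for t
  proof -
    obtain b where b: "t < b" "bounded (f ` ({t<..<b} \<inter> {0..T}))"
    proof (cases "t < T")
      case True
      then have "(f \<longlongrightarrow> f t) (at_right t)" using assms t by (auto simp: cadlag_def)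
      then have "\<forall>\<^sub>F x in at_right t. dist (f x) (f t) < 1" by (rule tendstoD) simp
      then obtain b where b: "t < b" "\<And>x. t < x \<Longrightarrow> x < b \<Longrightarrow> dist (f x) (f t) < 1"
        by (auto simp: eventually_at_right_field)
      have "bounded (f ` ({t<..<b} \<inter> {0..T}))" using b by (intro bdd_near_limit[of _ "f t"]) auto
      with b(1) show ?thesis by (rule that)
    next
      case False
      with t have "{t<..<t + 1} \<inter> {0..T} = {}" by auto
      then show ?thesis by (intro that[of "t + 1"]) simp_all
    qed
    obtain a where a: "a < t" "bounded (f ` ({a<..<t} \<inter> {0..T}))"
    proof (cases "0 < t")
      case True
      then have "\<exists>l. (f \<longlongrightarrow> l) (at_left t)" using assms t by (auto simp: cadlag_def)
      then obtain l where "(f \<longlongrightarrow> l) (at_left t)" ..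
      then have "\<forall>\<^sub>F x in at_left t. dist (f x) l < 1" by (rule tendstoD) simp
      then obtain a where a: "a < t" "\<And>x. a < x \<Longrightarrow> x < t \<Longrightarrow> dist (f x) l < 1"
        by (auto simp: eventually_at_left_field)
      have "bounded (f ` ({a<..<t} \<inter> {0..T}))" using a by (intro bdd_near_limit[of _ l]) auto
      with a(1) show ?thesis by (rule that)
    next
      case False
      with t have "{t - 1<..<t} \<inter> {0..T} = {}" by auto
      then show ?thesis by (intro that[of "t - 1"]) simp_all
    qed
    have "{a<..<b} \<inter> {0..T} \<subseteq> {a<..<t} \<inter> {0..T} \<union> {t} \<union> {t<..<b} \<inter> {0..T}" by auto
    then have "f ` ({a<..<b} \<inter> {0..T}) \<subseteq> f ` ({a<..<t} \<inter> {0..T}) \<union> {f t} \<union> f ` ({t<..<b} \<inter> {0..T})"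
      by blast
    then have "bounded (f ` ({a<..<b} \<inter> {0..T}))"
      by (rule bounded_subset[rotated]) (simp add: a b)
    then show ?thesis using a b by (intro exI[of _ "{a<..<b}"]) auto
  qed
  then obtain U where U: "\<And>t. t \<in> {0..T} \<Longrightarrow> open (U t) \<and> t \<in> U t \<and> bounded (f ` (U t \<inter> {0..T}))"
    by metis
  have "compact {0..T}" by simp
  then obtain F where F: "F \<subseteq> {0..T}" "finite F" "{0..T} \<subseteq> (\<Union>t\<in>F. U t)"
    by (rule compactE_image[of _ "{0..T}" U]) (use U in auto)
  have "bounded (\<Union>t\<in>F. f ` (U t \<inter> {0..T}))" using F U by (intro bounded_UN) auto
  then show ?thesis by (rule bounded_subset) (use F in blast)
qed

text \<open>
  A right-continuous path is the limit of its values at the times \<open>(\<lfloor>\<tau> m\<rfloor> + 1) / m\<close>,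
  which take countably many values.  These times are strictly later than \<open>\<tau>\<close>, as right limits require;
  they are cut off at \<open>T\<close>.
\<close>

lemma borel_measurable_cadlag_process_at:
  assumes Y: "cadlag_process M T Y" and T: "0 \<le> T"
    and [measurable]: "\<tau> \<in> borel_measurable M"
    and range: "\<And>\<omega>. \<omega> \<in> space M \<Longrightarrow> \<tau> \<omega> \<in> {0..T}"
  shows "(\<lambda>\<omega>. Y (\<tau> \<omega>) \<omega>) \<in> borel_measurable M"
proof (rule borel_measurable_LIMSEQ_real)
  define g where "g m j = max 0 (min T ((of_int j + 1) / real (Suc m)))" for m and j :: int
  show "(\<lambda>\<omega>. Y (g m \<lfloor>\<tau> \<omega> * real (Suc m)\<rfloor>) \<omega>) \<in> borel_measurable M" for m
  proof (rule measurable_compose_countable)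
    show "Y (g m j) \<in> borel_measurable M" for j
      using Y T by (auto simp: cadlag_process_def g_def)
  qed simp
  fix \<omega> assume \<omega>: "\<omega> \<in> space M"
  define u where "u m = (of_int \<lfloor>\<tau> \<omega> * real (Suc m)\<rfloor> + 1) / real (Suc m)" for m
  have u: "\<tau> \<omega> < u m" "u m \<le> \<tau> \<omega> + 1 / real (Suc m)" for m
  proof -
    have "\<tau> \<omega> * real (Suc m) < of_int \<lfloor>\<tau> \<omega> * real (Suc m)\<rfloor> + 1"
      and "of_int \<lfloor>\<tau> \<omega> * real (Suc m)\<rfloor> \<le> \<tau> \<omega> * real (Suc m)" by linarith+
    then show "\<tau> \<omega> < u m" "u m \<le> \<tau> \<omega> + 1 / real (Suc m)"
      unfolding u_def by (simp_all add: pos_less_divide_eq pos_divide_le_eq distrib_right del: of_nat_Suc)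
  qed
  have g: "g m \<lfloor>\<tau> \<omega> * real (Suc m)\<rfloor> = min T (u m)" for m
    using range[OF \<omega>] u(1)[of m] unfolding g_def u_def[symmetric] by (simp add: max_def)
  show "(\<lambda>m. Y (g m \<lfloor>\<tau> \<omega> * real (Suc m)\<rfloor>) \<omega>) \<longlonglongrightarrow> Y (\<tau> \<omega>) \<omega>"
  proof (cases "\<tau> \<omega> < T")
    case True
    have "u \<longlonglongrightarrow> \<tau> \<omega>"
    proof (rule tendsto_sandwich[where f="\<lambda>_. \<tau> \<omega>"])
      show "(\<lambda>m. \<tau> \<omega> + 1 / real (Suc m)) \<longlonglongrightarrow> \<tau> \<omega>"
        using tendsto_add[OF tendsto_const LIMSEQ_inverse_real_of_nat, of "\<tau> \<omega>"]
        by (simp add: inverse_eq_divide)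
    qed (use u in \<open>auto intro!: always_eventually intro: less_imp_le\<close>)
    then have "(\<lambda>m. min T (u m)) \<longlonglongrightarrow> min T (\<tau> \<omega>)" by (intro tendsto_intros)
    then have "filterlim (\<lambda>m. min T (u m)) (at_right (\<tau> \<omega>)) sequentially"
      using True u by (intro tendsto_imp_filterlim_at_right) auto
    moreover have "((\<lambda>t. Y t \<omega>) \<longlongrightarrow> Y (\<tau> \<omega>) \<omega>) (at_right (\<tau> \<omega>))"
      using Y \<omega> True range[OF \<omega>] by (auto simp: cadlag_process_def cadlag_def)
    ultimately show ?thesis unfolding g by (rule filterlim_compose[rotated])
  next
    case False
    then have "min T (u m) = \<tau> \<omega>" for m using range[OF \<omega>] u(1)[of m] by auto
    then show ?thesis unfolding g by simp
  qed
qed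

text \<open>
  Right-continuity at \<open>s\<close>, made uniform outside an event of small probability.  The oscillation just
  after \<open>s\<close> is tested at rational times only, which makes the exceptional sets events; they decrease
  to the empty set.
\<close>

lemma (in prob_space) cadlag_process_right_oscillation:
  assumes Y: "cadlag_process M T Y" and s: "0 \<le> s" "s < T" and e: "e > 0"
  obtains C h where "C \<in> events" "prob C \<le> e" "h > 0" "s + h \<le> T"
    "\<And>\<omega> u. \<omega> \<in> space M - C \<Longrightarrow> u \<in> {s..<s + h} \<Longrightarrow> \<bar>Y u \<omega> - Y s \<omega>\<bar> \<le> e"
proof -
  define h where "h m = (T - s) / real (Suc m)" for m
  define C where "C m = (\<Union>q\<in>\<rat> \<inter> {s..<s + h m}. {\<omega>\<in>space M. e < \<bar>Y q \<omega> - Y s \<omega>\<bar>})" for m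
  have h: "h m > 0" "s + h m \<le> T" for m
  proof -
    show "h m > 0" using s by (simp add: h_def)
    have "T - s \<le> (T - s) * real (Suc m)" using s by (simp add: mult_le_cancel_left1)
    then have "h m \<le> T - s" unfolding h_def by (simp add: divide_le_eq)
    then show "s + h m \<le> T" by simp
  qed
  have path: "((\<lambda>t. Y t \<omega>) \<longlongrightarrow> Y u \<omega>) (at_right u)" if "\<omega> \<in> space M" "u \<in> {0..<T}" for u \<omega>
    using Y that by (auto simp: cadlag_process_def cadlag_def)
  have C_events: "C m \<in> events" for m
    unfolding C_def
  proof (intro sets.countable_UN'' countable_Int1 countable_rat)
    fix q assume "q \<in> \<rat> \<inter> {s..<s + h m}"
    then have "q \<in> {0..T}" using h(2)[of m] s by auto
    then have [measurable]: "Y q \<in> borel_measurable M" "Y s \<in> borel_measurable M"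
      using Y s by (auto simp: cadlag_process_def)
    show "{\<omega>\<in>space M. e < \<bar>Y q \<omega> - Y s \<omega>\<bar>} \<in> events" by measurable
  qed
  have "decseq h"
    unfolding h_def using s by (intro decseq_SucI divide_left_mono) auto
  have "decseq C"
  proof (rule decseq_SucI)
    fix m show "C (Suc m) \<subseteq> C m"
      using decseqD[OF \<open>decseq h\<close>, of m "Suc m"] unfolding C_def by (intro UN_mono) auto
  qed
  have "(\<Inter>m. C m) = {}"
  proof (rule ccontr)
    assume "(\<Inter>m. C m) \<noteq> {}"
    then obtain \<omega> where \<omega>: "\<And>m. \<omega> \<in> C m" by auto
    then have "\<omega> \<in> space M" using C_events[of 0] sets.sets_into_space by blast
    from tendstoD[OF path[OF this, of s] e] s obtain b
      where b: "b > s" "\<And>u. s < u \<Longrightarrow> u < b \<Longrightarrow> \<bar>Y u \<omega> - Y s \<omega>\<bar> < e"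
      by (auto simp: eventually_at_right_field dist_real_def)
    have "h \<longlonglongrightarrow> 0"
      unfolding h_def using tendsto_mult[OF tendsto_const LIMSEQ_inverse_real_of_nat, of "T - s"]
      by (simp add: divide_inverse)
    from order_tendstoD(2)[OF this, of "b - s"] b obtain m where m: "h m < b - s"
      by (auto simp: eventually_sequentially)
    from \<omega>[of m] obtain q where "q \<in> {s..<s + h m}" "e < \<bar>Y q \<omega> - Y s \<omega>\<bar>" by (auto simp: C_def)
    with b(2)[of q] m e show False by (cases "q = s") auto
  qed
  then have "(\<lambda>m. prob (C m)) \<longlonglongrightarrow> 0"
    using finite_Lim_measure_decseq[of C] C_events \<open>decseq C\<close> by auto
  from order_tendstoD(2)[OF this e] obtain m where m: "prob (C m) < e"
    by (auto simp: eventually_sequentially)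
  show ?thesis
  proof (rule that[of "C m" "h m"])
    fix \<omega> u assume \<omega>: "\<omega> \<in> space M - C m" and u: "u \<in> {s..<s + h m}"
    show "\<bar>Y u \<omega> - Y s \<omega>\<bar> \<le> e"
    proof (rule ccontr)
      assume "\<not> ?thesis"
      then have gt: "e < \<bar>Y u \<omega> - Y s \<omega>\<bar>" by simp
      have "((\<lambda>t. \<bar>Y t \<omega> - Y s \<omega>\<bar>) \<longlongrightarrow> \<bar>Y u \<omega> - Y s \<omega>\<bar>) (at_right u)"
        using path[of \<omega> u] \<omega> u s h(2)[of m] by (intro tendsto_intros) auto
      from order_tendstoD(1)[OF this gt] obtain b
        where b: "b > u" "\<And>t. u < t \<Longrightarrow> t < b \<Longrightarrow> e < \<bar>Y t \<omega> - Y s \<omega>\<bar>"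
        by (auto simp: eventually_at_right_field)
      obtain q where q: "q \<in> \<rat>" "u < q" "q < min b (s + h m)"
        using Rats_dense_in_real[of u "min b (s + h m)"] b u by auto
      with b(2)[of q] u \<omega> show False by (auto simp: C_def)
    qed
  qed (use m h C_events in auto)
qed

text \<open>
  Taking only countably many times keeps the supremum of the path measurable.
\<close>

lemma (in prob_space) cadlag_process_bounded_in_prob:
  assumes Y: "cadlag_process M T Y" and D: "countable D" "D \<subseteq> {0..T}" and e: "e > 0"
  obtains K where "(\<Union>t\<in>D. {\<omega>\<in>space M. K < \<bar>Y t \<omega>\<bar>}) \<in> events"
    "prob (\<Union>t\<in>D. {\<omega>\<in>space M. K < \<bar>Y t \<omega>\<bar>}) \<le> e"
proof -
  define B where "B m = (\<Union>t\<in>D. {\<omega>\<in>space M. real m < \<bar>Y t \<omega>\<bar>})" for m :: nat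
  have B_event: "B m \<in> events" for m
    unfolding B_def
  proof (intro sets.countable_UN'' D(1))
    fix t assume "t \<in> D"
    then have [measurable]: "Y t \<in> borel_measurable M" using Y D by (auto simp: cadlag_process_def)
    show "{\<omega>\<in>space M. real m < \<bar>Y t \<omega>\<bar>} \<in> events" by measurable
  qed
  have "decseq B" unfolding B_def by (intro decseq_SucI UN_mono) auto
  moreover have "(\<Inter>m. B m) = {}"
  proof (rule ccontr)
    assume "(\<Inter>m. B m) \<noteq> {}"
    then obtain \<omega> where \<omega>: "\<And>m. \<omega> \<in> B m" by auto
    then have "\<omega> \<in> space M" using B_event[of 0] sets.sets_into_space by blast
    then have "bounded ((\<lambda>t. Y t \<omega>) ` {0..T})"
      using Y by (intro cadlag_imp_bounded) (auto simp: cadlag_process_def)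
    then obtain b where b: "\<forall>t\<in>{0..T}. \<bar>Y t \<omega>\<bar> \<le> b" by (auto simp: bounded_iff)
    obtain m :: nat where "b < real m" using reals_Archimedean2 by blast
    moreover from \<omega>[of m] obtain t where "t \<in> D" "real m < \<bar>Y t \<omega>\<bar>" by (auto simp: B_def)
    ultimately show False using b D by fastforce
  qed
  ultimately have "(\<lambda>m. prob (B m)) \<longlonglongrightarrow> 0"
    using finite_Lim_measure_decseq[of B] B_event by auto
  from order_tendstoD(2)[OF this e] obtain m where "prob (B m) < e"
    by (auto simp: eventually_sequentially)
  then show ?thesis using B_event[of m] by (intro that[of "real m"]) (auto simp: B_def)
qed

section \<open>Skorokhod convergence at a lagged time\<close>

text \<open>
  Since time changes fix \<open>T\<close>, the lagged times below can be cut off at \<open>T\<close>.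
\<close>

lemma time_changes_end:
  assumes "l \<in> time_changes T" "0 \<le> T"
  shows "l T = T"
proof -
  have mono: "strict_mono_on {0..T} l" and img: "l ` {0..T} = {0..T}"
    using assms by (auto simp: time_changes_def)
  have "T \<in> l ` {0..T}" unfolding img using assms(2) by simp
  then obtain u where u: "u \<in> {0..T}" "l u = T" by auto
  have "l T \<in> l ` {0..T}" using assms(2) by (intro imageI) simp
  then have "l T \<in> {0..T}" unfolding img .
  with strict_mono_onD[OF mono u(1), of T] u show ?thesis
    by (cases "u = T") auto
qed

lemma skorokhod_dist_less:
  assumes "skorokhod_dist T f g < ennreal e"
  obtains l where "l \<in> time_changes T"
    "\<And>t. t \<in> {0..T} \<Longrightarrow> \<bar>l t - t\<bar> < e" "\<And>t. t \<in> {0..T} \<Longrightarrow> \<bar>f t - g (l t)\<bar> < e"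
proof -
  from assms obtain l where l: "l \<in> time_changes T"
    and "max (SUP t\<in>{0..T}. ennreal \<bar>l t - t\<bar>) (SUP t\<in>{0..T}. ennreal \<bar>f t - g (l t)\<bar>) < ennreal e"
    unfolding skorokhod_dist_def by (auto simp: INF_less_iff simp del: max_less_iff_conj)
  then have *: "(SUP t\<in>{0..T}. ennreal \<bar>l t - t\<bar>) < ennreal e"
      "(SUP t\<in>{0..T}. ennreal \<bar>f t - g (l t)\<bar>) < ennreal e" by auto
  show ?thesis
  proof (rule that[OF l])
    fix t assume t: "t \<in> {0..T}"
    have "ennreal \<bar>l t - t\<bar> < ennreal e"
      by (rule le_less_trans[OF SUP_upper[OF t] *(1)])
    then show "\<bar>l t - t\<bar> < e" by (simp add: ennreal_less_iff)
    have "ennreal \<bar>f t - g (l t)\<bar> < ennreal e"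
      by (rule le_less_trans[OF SUP_upper[OF t] *(2)])
    then show "\<bar>f t - g (l t)\<bar> < e" by (simp add: ennreal_less_iff)
  qed
qed

lemma outer_measure_of_Un_event:
  assumes "C \<in> sets M" "B \<subseteq> space M"
  shows "outer_measure_of M (B \<union> C) \<le> outer_measure_of M B + emeasure M C"
proof -
  obtain E where E: "E \<in> sets M" "B \<subseteq> E" "outer_measure_of M B = emeasure M E"
    using outer_measure_of_attain[OF assms(2)] by auto
  have "outer_measure_of M (B \<union> C) \<le> outer_measure_of M (E \<union> C)"
    using E by (intro outer_measure_of_mono) auto
  also have "\<dots> = emeasure M (E \<union> C)" using E assms by simp
  also have "\<dots> \<le> emeasure M E + emeasure M C" using E assms by (intro emeasure_subadditive) auto
  finally show ?thesis using E by simp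
qed

text \<open>
  Skorokhod convergence does not control the value at a time \<open>s\<close> where \<open>Y\<close> jumps.  At \<open>s + h\<close> it does:
  a time change displacing times by less than \<open>h\<close> maps \<open>s + h\<close> to a time after \<open>s\<close>, where \<open>Y\<close> is
  close to \<open>Y s\<close>.
\<close>

lemma (in prob_space) skorokhod_conv_lagged:
  assumes conv: "skorokhod_conv_in_prob M T Yn Y" and Y: "cadlag_process M T Y"
    and s: "0 \<le> s" "s \<le> T" and e: "e > 0"
  shows "\<forall>\<^sub>F h in at_right 0. \<forall>\<^sub>F n in sequentially.
    outer_measure_of M {\<omega>\<in>space M. e < \<bar>Yn n (min T (s + h)) \<omega> - Y s \<omega>\<bar>} \<le> ennreal e"
proof -
  obtain C h0 where C: "C \<in> events" "prob C \<le> e / 2" "h0 > 0"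
    and osc: "\<And>\<omega> u. \<omega> \<in> space M - C \<Longrightarrow> u \<in> {s..<s + h0} \<Longrightarrow> u \<le> T \<Longrightarrow> \<bar>Y u \<omega> - Y s \<omega>\<bar> \<le> e / 2"
  proof (cases "s < T")
    case True
    from e have "e / 2 > 0" by simp
    obtain C h where C: "C \<in> events" "prob C \<le> e / 2" "h > 0" "s + h \<le> T"
      and osc: "\<And>\<omega> u. \<omega> \<in> space M - C \<Longrightarrow> u \<in> {s..<s + h} \<Longrightarrow> \<bar>Y u \<omega> - Y s \<omega>\<bar> \<le> e / 2"
      by (rule cadlag_process_right_oscillation[OF Y s(1) True \<open>e / 2 > 0\<close>]) iprover
    show ?thesis by (rule that[OF C(1-3) osc])
  next
    case False
    with s have "s = T" by simp
    show ?thesis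
    proof (rule that[of "{}" 1])
      fix \<omega> u assume "u \<in> {s..<s + 1}" "u \<le> T"
      with \<open>s = T\<close> e show "\<bar>Y u \<omega> - Y s \<omega>\<bar> \<le> e / 2" by simp
    qed (use e in simp_all)
  qed
  show ?thesis
    unfolding eventually_at_right_field
  proof (intro exI[of _ "h0 / 2"] conjI allI impI)
    show "0 < h0 / 2" using C by simp
    fix h :: real assume h: "0 < h" "h < h0 / 2"
    \<comment> \<open>displacement below the lag and vertical distance below half of the error\<close>
    define d where "d = min h (e / 2)"
    have "d > 0" using h e by (simp add: d_def)
    let ?D = "\<lambda>n. {\<omega>\<in>space M. skorokhod_dist T (\<lambda>t. Yn n t \<omega>) (\<lambda>t. Y t \<omega>) \<ge> ennreal d}"
    have "(\<lambda>n. outer_measure_of M (?D n)) \<longlonglongrightarrow> 0"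
      using conv \<open>d > 0\<close> unfolding skorokhod_conv_in_prob_def by blast
    then have "\<forall>\<^sub>F n in sequentially. outer_measure_of M (?D n) < ennreal (e / 2)"
      by (rule order_tendstoD) (use e in simp)
    then show "\<forall>\<^sub>F n in sequentially.
      outer_measure_of M {\<omega>\<in>space M. e < \<bar>Yn n (min T (s + h)) \<omega> - Y s \<omega>\<bar>} \<le> ennreal e"
    proof eventually_elim
      case (elim n)
      have "{\<omega>\<in>space M. e < \<bar>Yn n (min T (s + h)) \<omega> - Y s \<omega>\<bar>} \<subseteq> ?D n \<union> C"
      proof (rule ccontr)
        let ?t = "min T (s + h)"
        assume "\<not> ?thesis"
        then obtain \<omega> where \<omega>: "\<omega> \<in> space M - C" "e < \<bar>Yn n ?t \<omega> - Y s \<omega>\<bar>"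
          and "skorokhod_dist T (\<lambda>t. Yn n t \<omega>) (\<lambda>t. Y t \<omega>) < ennreal d" by (auto simp: subset_eq not_le not_less)
        then obtain l where l: "l \<in> time_changes T" "\<And>t. t \<in> {0..T} \<Longrightarrow> \<bar>l t - t\<bar> < d"
          "\<And>t. t \<in> {0..T} \<Longrightarrow> \<bar>Yn n t \<omega> - Y (l t) \<omega>\<bar> < d"
          by (auto elim: skorokhod_dist_less)
        have t: "?t \<in> {0..T}" using s h by auto
        have "l ?t \<in> {0..T}" using l(1) t by (auto simp: time_changes_def)
        moreover have "l ?t \<in> {s..<s + h0}"
        proof (cases "s + h \<le> T")
          case True
          then have "?t = s + h" by simp
          moreover have "\<bar>l ?t - ?t\<bar> < h" using l(2)[OF t] by (simp add: d_def)
          ultimately show ?thesis using h by auto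
        next
          case False
          then show ?thesis using time_changes_end[OF l(1)] s h by (auto simp: min_def)
        qed
        ultimately have "\<bar>Y (l ?t) \<omega> - Y s \<omega>\<bar> \<le> e / 2" using osc \<omega> by auto
        moreover have "\<bar>Yn n ?t \<omega> - Y (l ?t) \<omega>\<bar> < e / 2" using l(3)[OF t] by (simp add: d_def)
        ultimately show False using \<omega>(2) by linarith
      qed
      then have "outer_measure_of M {\<omega>\<in>space M. e < \<bar>Yn n (min T (s + h)) \<omega> - Y s \<omega>\<bar>}
          \<le> outer_measure_of M (?D n \<union> C)" by (rule outer_measure_of_mono)
      also have "\<dots> \<le> outer_measure_of M (?D n) + emeasure M C"
        using C by (intro outer_measure_of_Un_event) auto
      also have "\<dots> \<le> ennreal (e / 2) + ennreal (e / 2)"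
        using elim C by (intro add_mono) (auto simp: emeasure_eq_measure intro: ennreal_leI)
      also have "\<dots> = ennreal e" using e by (simp flip: ennreal_plus)
      finally show ?case .
    qed
  qed
qed

section \<open>Filtrations generated by a process\<close>

lemma subalgebra_natural_filtration:
  assumes "cadlag_process M T Y" "t \<le> T"
  shows "subalgebra M (natural_filtration M Y t)"
  unfolding subalgebra_def
proof
  show "sets (natural_filtration M Y t) \<subseteq> sets M"
    unfolding natural_filtration_def
    using assms by (intro sets.sigma_sets_subset' sets_measure_of[THEN equalityD1, THEN subset_trans])
      (auto simp: cadlag_process_def intro!: measurable_sets)
qed simp

lemma sets_natural_filtration:
  "sets (natural_filtration M Y t) =
    sigma_sets (space M) {Y s -` B \<inter> space M | s B. s \<in> {0..t} \<and> B \<in> sets borel}"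
  unfolding natural_filtration_def by (rule sets_measure_of) auto

lemma natural_filtration_mono:
  assumes "s \<le> t"
  shows "sets (natural_filtration M Y s) \<subseteq> sets (natural_filtration M Y t)"
proof -
  have "{0..s} \<subseteq> {0..t}" using assms by auto
  then show ?thesis unfolding sets_natural_filtration by (intro sigma_sets_mono') blast
qed

lemma borel_measurable_natural_filtration:
  assumes "0 \<le> s" "s \<le> t"
  shows "Y s \<in> borel_measurable (natural_filtration M Y t)"
proof (rule measurableI)
  fix B :: "real set" assume "B \<in> sets borel"
  then show "Y s -` B \<inter> space (natural_filtration M Y t) \<in> sets (natural_filtration M Y t)"
    using assms unfolding space_natural_filtration sets_natural_filtration
    by (auto intro!: sigma_sets.Basic)
qed simp

lemma natural_filtration_subset_right_cont_filtration:
  assumes "t \<le> T"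
  shows "sets (natural_filtration M Y t) \<subseteq> sets (right_cont_filtration M T Y t)"
proof (cases "t < T")
  case True
  show ?thesis unfolding sets_right_cont_filtration[OF True]
    by (intro INF_greatest natural_filtration_mono) simp
next
  case False
  with assms show ?thesis by (simp add: right_cont_filtration_def)
qed

lemma right_cont_filtration_subset_natural_filtration:
  "sets (right_cont_filtration M T Y t) \<subseteq> sets (natural_filtration M Y T)"
proof (cases "t < T")
  case True
  then show ?thesis unfolding sets_right_cont_filtration[OF True] by (intro INF_lower) simp
qed (simp add: right_cont_filtration_def)

lemma space_right_cont_filtration [simp]: "space (right_cont_filtration M T Y t) = space M"
proof (cases "t < T")
  case True
  have "(\<Inter>s\<in>{t<..T}. sets (natural_filtration M Y s)) \<subseteq> Pow (space M)"
    using True sets.space_closed[of "natural_filtration M Y T"]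
    by (intro order_trans[OF INF_lower[of T]]) auto
  with True show ?thesis by (simp add: right_cont_filtration_def space_measure_of_conv)
qed (simp add: right_cont_filtration_def)

lemma subalgebra_right_cont_filtration:
  assumes "cadlag_process M T Y"
  shows "subalgebra M (right_cont_filtration M T Y t)"
  using subalgebra_natural_filtration[OF assms order_refl]
    right_cont_filtration_subset_natural_filtration[of M T Y t]
  by (auto simp: subalgebra_def)

lemma right_cont_filtration_mono:
  assumes "s \<le> t"
  shows "sets (right_cont_filtration M T Y s) \<subseteq> sets (right_cont_filtration M T Y t)"
proof (cases "t < T")
  case True
  with assms show ?thesis by (auto simp: sets_right_cont_filtration)
next
  case False
  then show ?thesis
    using right_cont_filtration_subset_natural_filtration[of M T Y s]
    by (simp add: right_cont_filtration_def)
qed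

section \<open>Weak convergence of filtrations and conditional expectations\<close>

lemma (in sigma_finite_subalgebra) real_cond_exp_L1_contraction:
  assumes f: "integrable M f"
  shows "(\<integral>x. \<bar>real_cond_exp M F f x\<bar> \<partial>M) \<le> (\<integral>x. \<bar>f x\<bar> \<partial>M)"
proof -
  have "AE x in M. real_cond_exp M F f x \<le> real_cond_exp M F (\<lambda>x. \<bar>f x\<bar>) x"
    using f by (intro real_cond_exp_mono) auto
  moreover have "AE x in M. real_cond_exp M F (\<lambda>x. - 1 * f x) x \<le> real_cond_exp M F (\<lambda>x. \<bar>f x\<bar>) x"
    using f by (intro real_cond_exp_mono) auto
  moreover have "AE x in M. real_cond_exp M F (\<lambda>x. - 1 * f x) x = - 1 * real_cond_exp M F f x"
    using f by (rule real_cond_exp_cmult)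
  ultimately have "AE x in M. \<bar>real_cond_exp M F f x\<bar> \<le> real_cond_exp M F (\<lambda>x. \<bar>f x\<bar>) x"
    by eventually_elim auto
  then have "(\<integral>x. \<bar>real_cond_exp M F f x\<bar> \<partial>M) \<le> (\<integral>x. real_cond_exp M F (\<lambda>x. \<bar>f x\<bar>) x \<partial>M)"
    using f by (intro integral_mono_AE integrable_abs real_cond_exp_int) auto
  also have "\<dots> = (\<integral>x. \<bar>f x\<bar> \<partial>M)" using f by (intro real_cond_exp_int) auto
  finally show ?thesis .
qed

text \<open>
  The point is that \<open>B\<close> is known to \<open>G n\<close> already at time \<open>s\<close>, hence also at the later time
  \<open>u = s + h\<close>: integrating over \<open>B\<close>, the indicator of \<open>A\<close> can be replaced by its conditional expectation
  at time \<open>u\<close>, which is the lagged value that converges even if the limit martingale jumps at \<open>s\<close>.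
\<close>

lemma (in prob_space) weak_filtration_conv_indicator:
  assumes subG: "\<And>n t. t \<in> {0..T} \<Longrightarrow> subalgebra M (G n t)"
    and subF: "\<And>t. t \<in> {0..T} \<Longrightarrow> subalgebra M (F t)"
    and monoG: "\<And>n s t. s \<le> t \<Longrightarrow> sets (G n s) \<subseteq> sets (G n t)"
    and conv: "weak_filtration_conv M T G F"
    and s: "0 \<le> s" "s < T" and A: "A \<in> sets (F T)" and e: "e > 0"
  shows "\<forall>\<^sub>F n in sequentially. \<forall>B\<in>sets (G n s).
    \<bar>\<integral>x. indicator B x * (indicator A x - real_cond_exp M (F s) (indicator A) x) \<partial>M\<bar> \<le> e"
proof -
  from conv A obtain Zn Z where Zn: "\<And>n. cadlag_cond_prob M T (G n) A (Zn n)"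
    and Z: "cadlag_cond_prob M T F A Z" and lim: "skorokhod_conv_in_prob M T Zn Z"
    unfolding weak_filtration_conv_def by metis
  have A_event [measurable]: "A \<in> events"
    using A subF[of T] s by (auto simp: subalgebra_def)
  have "\<forall>\<^sub>F h in at_right 0. 0 < h \<and> h < T - s"
    using s by (auto simp: eventually_at_right_field intro: exI[of _ "T - s"])
  moreover have "\<forall>\<^sub>F h in at_right 0. \<forall>\<^sub>F n in sequentially.
    outer_measure_of M {\<omega>\<in>space M. e / 2 < \<bar>Zn n (min T (s + h)) \<omega> - Z s \<omega>\<bar>} \<le> ennreal (e / 2)"
    using lim Z s e by (intro skorokhod_conv_lagged) (auto simp: cadlag_cond_prob_def)
  ultimately have "\<forall>\<^sub>F h in at_right 0. (0 < h \<and> h < T - s) \<and> (\<forall>\<^sub>F n in sequentially.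
    outer_measure_of M {\<omega>\<in>space M. e / 2 < \<bar>Zn n (min T (s + h)) \<omega> - Z s \<omega>\<bar>} \<le> ennreal (e / 2))"
    by (rule eventually_conj)
  from eventually_happens'[OF _ this] obtain h where h: "0 < h" "h < T - s"
    and ev: "\<forall>\<^sub>F n in sequentially.
      outer_measure_of M {\<omega>\<in>space M. e / 2 < \<bar>Zn n (min T (s + h)) \<omega> - Z s \<omega>\<bar>} \<le> ennreal (e / 2)"
    by auto
  define u where "u = s + h"
  have u: "u \<in> {0..T}" "s \<le> u" "min T (s + h) = u" using h s by (auto simp: u_def)
  have int_A: "integrable M (indicator A :: 'a \<Rightarrow> real)"
    by (intro integrable_const_bound[where B = 1]) auto
  have cond_prob: "AE x in M. real_cond_exp M H (indicator A) x \<in> {0..1}" (is ?bounds)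
      "integrable M (real_cond_exp M H (indicator A))" (is ?int)
      "\<And>B. B \<in> sets H \<Longrightarrow> (\<integral>x. indicator B x * real_cond_exp M H (indicator A) x \<partial>M)
        = (\<integral>x. indicator B x * indicator A x \<partial>M)"
    if H: "subalgebra M H" for H
  proof -
    interpret H: finite_measure_subalgebra M H using H by unfold_locales
    have "AE x in M. real_cond_exp M H (indicator A) x \<le> real_cond_exp M H (\<lambda>_. 1) x"
      using int_A by (intro H.real_cond_exp_mono) (auto simp: indicator_def)
    moreover have "AE x in M. real_cond_exp M H (\<lambda>_. 1) x = 1"
      by (intro H.real_cond_exp_F_meas) auto
    moreover have "AE x in M. 0 \<le> real_cond_exp M H (indicator A) x"
      by (intro H.real_cond_exp_pos) auto
    ultimately show ?bounds by eventually_elim auto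
    show ?int using int_A by (rule H.real_cond_exp_int)
    show "(\<integral>x. indicator B x * real_cond_exp M H (indicator A) x \<partial>M)
        = (\<integral>x. indicator B x * indicator A x \<partial>M)" if "B \<in> sets H" for B
      using H.real_cond_exp_intA[OF int_A that] by (simp add: set_lebesgue_integral_def)
  qed
  have Z_meas [measurable]: "Z s \<in> borel_measurable M" and Z_ae: "AE x in M. Z s x = real_cond_exp M (F s) (indicator A) x"
    using Z s by (auto simp: cadlag_cond_prob_def cadlag_process_def)
  have "subalgebra M (F s)" using subF s by simp
  note rF = cond_prob(1,2)[OF this]
  from ev show ?thesis
  proof eventually_elim
    case (elim n)
    have Zn_meas [measurable]: "Zn n u \<in> borel_measurable M"
      and Zn_ae: "AE x in M. Zn n u x = real_cond_exp M (G n u) (indicator A) x"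
      using Zn[of n] u by (auto simp: cadlag_cond_prob_def cadlag_process_def)
    note rG = cond_prob(1,2)[OF subG[OF u(1), of n]] and rG_int = cond_prob(3)[OF subG[OF u(1), of n]]
    let ?E = "{\<omega>\<in>space M. e / 2 < \<bar>Zn n u \<omega> - Z s \<omega>\<bar>}"
    have E_event: "?E \<in> events" by measurable
    have prob_E: "prob ?E \<le> e / 2"
      using elim E_event e u by (simp add: emeasure_eq_measure)
    let ?d = "\<lambda>x. real_cond_exp M (G n u) (indicator A) x - real_cond_exp M (F s) (indicator A) x"
    have int_d: "integrable M ?d" using rF rG by auto
    have int_E: "integrable M (indicator ?E :: 'a \<Rightarrow> real)"
      using E_event by (intro integrable_const_bound[where B = 1]) auto
    \<comment> \<open>both conditional probabilities lie between \<open>0\<close> and \<open>1\<close>, so convergence in probability gives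
      convergence in mean\<close>
    have "AE x in M. \<bar>?d x\<bar> \<le> e / 2 + indicator ?E x"
      using Z_ae Zn_ae rF(1) rG(1) AE_space
    proof eventually_elim
      case (elim x)
      then show ?case using e by (cases "x \<in> ?E") auto
    qed
    then have "(\<integral>x. \<bar>?d x\<bar> \<partial>M) \<le> (\<integral>x. e / 2 + indicator ?E x \<partial>M)"
      using int_d int_E by (intro integral_mono_AE Bochner_Integration.integrable_add) auto
    also have "\<dots> = e / 2 + prob ?E"
      using E_event int_E by (subst Bochner_Integration.integral_add) (simp_all add: prob_space)
    finally have small: "(\<integral>x. \<bar>?d x\<bar> \<partial>M) \<le> e" using prob_E by simp
    show ?case
    proof
      fix B assume B: "B \<in> sets (G n s)"
      then have B_u: "B \<in> sets (G n u)" using monoG[OF u(2)] by auto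
      then have "B \<in> events" using subG[OF u(1)] by (auto simp: subalgebra_def)
      then have int_mult: "integrable M (\<lambda>x. indicator B x * f x)" if "integrable M f" for f :: "'a \<Rightarrow> real"
        using integrable_mult_indicator[of B M f] that by simp
      have "(\<integral>x. indicator B x * (indicator A x - real_cond_exp M (F s) (indicator A) x) \<partial>M)
          = (\<integral>x. indicator B x * indicator A x \<partial>M) - (\<integral>x. indicator B x * real_cond_exp M (F s) (indicator A) x \<partial>M)"
        unfolding right_diff_distrib using rF(2) int_A
        by (intro Bochner_Integration.integral_diff int_mult)
      also have "\<dots> = (\<integral>x. indicator B x * ?d x \<partial>M)"
        unfolding rG_int[OF B_u, symmetric] right_diff_distrib using rF(2) rG(2)
        by (intro Bochner_Integration.integral_diff[symmetric] int_mult)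
      finally have "\<bar>\<integral>x. indicator B x * (indicator A x - real_cond_exp M (F s) (indicator A) x) \<partial>M\<bar>
          \<le> (\<integral>x. \<bar>indicator B x * ?d x\<bar> \<partial>M)" by (simp only: integral_abs_bound)
      also have "\<dots> \<le> (\<integral>x. \<bar>?d x\<bar> \<partial>M)"
        using int_d by (intro integral_mono integrable_abs int_mult) (auto simp: indicator_def)
      also note small
      finally show "\<bar>\<integral>x. indicator B x * (indicator A x - real_cond_exp M (F s) (indicator A) x) \<partial>M\<bar> \<le> e" .
    qed
  qed
qed

text \<open>
  The error is linear in \<open>D\<close> and bounded by twice the \<open>L\<^sup>1\<close> norm of \<open>D\<close>, uniformly in \<open>B\<close> and \<open>n\<close>; so
  the case of indicators extends to simple functions and then to their \<open>L\<^sup>1\<close> limits.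
\<close>

lemma (in prob_space) weak_filtration_conv_integrable:
  assumes subG: "\<And>n t. t \<in> {0..T} \<Longrightarrow> subalgebra M (G n t)"
    and subF: "\<And>t. t \<in> {0..T} \<Longrightarrow> subalgebra M (F t)"
    and monoG: "\<And>n s t. s \<le> t \<Longrightarrow> sets (G n s) \<subseteq> sets (G n t)"
    and conv: "weak_filtration_conv M T G F"
    and s: "0 \<le> s" "s < T" and D: "integrable M D" "D \<in> borel_measurable (F T)" and e: "e > 0"
  shows "\<forall>\<^sub>F n in sequentially. \<forall>B\<in>sets (G n s).
    \<bar>\<integral>x. indicator B x * (D x - real_cond_exp M (F s) D x) \<partial>M\<bar> \<le> e"
proof -
  let ?N = "restr_to_subalg M (F T)"
  have T: "T \<in> {0..T}" "s \<in> {0..T}" using s by auto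
  interpret Fs: finite_measure_subalgebra M "F s" using subF[OF T(2)] by unfold_locales
  define err where "err B f = (\<integral>x. indicator B x * (f x - real_cond_exp M (F s) f x) \<partial>M)" for B f
  have from_N: "integrable M f" if "integrable ?N f" for f :: "'a \<Rightarrow> real"
    using integrable_from_subalg[OF subF[OF T(1)] that] .
  have int_err: "integrable M (\<lambda>x. indicator B x * (f x - real_cond_exp M (F s) f x))"
    if "B \<in> events" "integrable M f" for B f
    using that Fs.real_cond_exp_int(1)[OF that(2)]
    by (auto simp: mult.commute[of "indicator B _"] intro!: integrable_real_mult_indicator)
  have meas_err: "(\<lambda>x. indicator B x * (f x - real_cond_exp M (F s) f x)) \<in> borel_measurable M"
    if "B \<in> events" "integrable M f" for B f
    using int_err[OF that] by auto
  have err_add: "err B (\<lambda>x. f x + g x) = err B f + err B g"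
    if B: "B \<in> events" and f: "integrable M f" and g: "integrable M g" for B f g
  proof -
    have "err B (\<lambda>x. f x + g x) = (\<integral>x. indicator B x * (f x - real_cond_exp M (F s) f x) +
        indicator B x * (g x - real_cond_exp M (F s) g x) \<partial>M)"
      unfolding err_def
    proof (rule integral_cong_AE)
      show "AE x in M. indicator B x * (f x + g x - real_cond_exp M (F s) (\<lambda>x. f x + g x) x) =
        indicator B x * (f x - real_cond_exp M (F s) f x) +
        indicator B x * (g x - real_cond_exp M (F s) g x)"
        using Fs.real_cond_exp_add[OF f g] by eventually_elim (simp add: algebra_simps)
    qed (use B f g in \<open>auto intro!: meas_err borel_measurable_add\<close>)
    also have "\<dots> = err B f + err B g"
      unfolding err_def using B f g by (intro Bochner_Integration.integral_add int_err)
    finally show ?thesis .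
  qed
  have err_cmult: "err B (\<lambda>x. c * f x) = c * err B f"
    if B: "B \<in> events" and f: "integrable M f" for B f and c :: real
  proof -
    have "err B (\<lambda>x. c * f x) = (\<integral>x. c * (indicator B x * (f x - real_cond_exp M (F s) f x)) \<partial>M)"
      unfolding err_def
    proof (rule integral_cong_AE)
      show "AE x in M. indicator B x * (c * f x - real_cond_exp M (F s) (\<lambda>x. c * f x) x) =
        c * (indicator B x * (f x - real_cond_exp M (F s) f x))"
        using Fs.real_cond_exp_cmult[OF f, of c] by eventually_elim (simp add: algebra_simps)
    qed (use B f in \<open>auto intro!: meas_err borel_measurable_times\<close>)
    then show ?thesis by (simp add: err_def)
  qed
  \<comment> \<open>conditional expectation contracts the \<open>L\<^sup>1\<close> norm\<close>
  have err_bound: "\<bar>err B f\<bar> \<le> 2 * (\<integral>x. \<bar>f x\<bar> \<partial>M)"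
    if B: "B \<in> events" and f: "integrable M f" for B f
  proof -
    have "\<bar>err B f\<bar> \<le> (\<integral>x. \<bar>indicator B x * (f x - real_cond_exp M (F s) f x)\<bar> \<partial>M)"
      unfolding err_def by (rule integral_abs_bound)
    also have "\<dots> \<le> (\<integral>x. \<bar>f x\<bar> + \<bar>real_cond_exp M (F s) f x\<bar> \<partial>M)"
      using Fs.real_cond_exp_int(1)[OF f] f B
      by (intro integral_mono integrable_abs int_err Bochner_Integration.integrable_add)
        (auto simp: indicator_def)
    also have "\<dots> = (\<integral>x. \<bar>f x\<bar> \<partial>M) + (\<integral>x. \<bar>real_cond_exp M (F s) f x\<bar> \<partial>M)"
      using Fs.real_cond_exp_int(1)[OF f] f by (intro Bochner_Integration.integral_add) auto
    finally show ?thesis using Fs.real_cond_exp_L1_contraction[OF f] by simp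
  qed
  have B_event: "B \<in> events" if "B \<in> sets (G n s)" for B n
    using subG[OF T(2)] that by (auto simp: subalgebra_def)
  have "integrable ?N D" using integrable_in_subalg[OF subF[OF T(1)] D(2,1)] .
  then have "\<forall>e>0. \<forall>\<^sub>F n in sequentially. \<forall>B\<in>sets (G n s). \<bar>err B D\<bar> \<le> e"
  proof (induction rule: integrable_induct)
    case (base A c)
    then have A: "A \<in> sets (F T)" by (simp add: sets_restr_to_subalg[OF subF[OF T(1)]])
    then have [measurable]: "A \<in> events" using subF[OF T(1)] by (auto simp: subalgebra_def)
    have int_A: "integrable M (indicator A :: 'a \<Rightarrow> real)"
      by (intro integrable_const_bound[where B = 1]) auto
    show ?case
    proof (intro allI impI)
      fix e :: real assume "e > 0"
      then have pos: "e / (\<bar>c\<bar> + 1) > 0" by simp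
      have "\<forall>\<^sub>F n in sequentially. \<forall>B\<in>sets (G n s).
          \<bar>\<integral>x. indicator B x * (indicator A x - real_cond_exp M (F s) (indicator A) x) \<partial>M\<bar> \<le> e / (\<bar>c\<bar> + 1)"
        by (rule weak_filtration_conv_indicator[where T = T and F = F]) (fact subG subF monoG conv s A pos)+
      then show "\<forall>\<^sub>F n in sequentially. \<forall>B\<in>sets (G n s). \<bar>err B (\<lambda>x. indicator A x *\<^sub>R c)\<bar> \<le> e"
      proof eventually_elim
        case (elim n)
        show ?case
        proof
          fix B assume B: "B \<in> sets (G n s)"
          have "\<bar>err B (\<lambda>x. indicator A x *\<^sub>R c)\<bar> = \<bar>c\<bar> * \<bar>err B (indicator A)\<bar>"
            using err_cmult[OF B_event[OF B] int_A, of c] by (simp add: mult.commute abs_mult)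
          also have "\<dots> \<le> \<bar>c\<bar> * (e / (\<bar>c\<bar> + 1))"
            using elim B by (intro mult_left_mono) (auto simp: err_def)
          also have "\<dots> \<le> e" using \<open>e > 0\<close> by (simp add: field_simps)
          finally show "\<bar>err B (\<lambda>x. indicator A x *\<^sub>R c)\<bar> \<le> e" .
        qed
      qed
    qed
  next
    case (add f g)
    show ?case
    proof (intro allI impI)
      fix e :: real assume "e > 0"
      then have "e / 2 > 0" by simp
      with add have "\<forall>\<^sub>F n in sequentially. \<forall>B\<in>sets (G n s). \<bar>err B f\<bar> \<le> e / 2"
        "\<forall>\<^sub>F n in sequentially. \<forall>B\<in>sets (G n s). \<bar>err B g\<bar> \<le> e / 2" by blast+
      then show "\<forall>\<^sub>F n in sequentially. \<forall>B\<in>sets (G n s). \<bar>err B (\<lambda>x. f x + g x)\<bar> \<le> e"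
      proof eventually_elim
        case (elim n)
        show ?case
        proof
          fix B assume B: "B \<in> sets (G n s)"
          with elim have "\<bar>err B f\<bar> \<le> e / 2" "\<bar>err B g\<bar> \<le> e / 2" by auto
          then show "\<bar>err B (\<lambda>x. f x + g x)\<bar> \<le> e"
            using err_add[OF B_event[OF B] from_N[OF add.hyps(1)] from_N[OF add.hyps(2)]] by simp
        qed
      qed
    qed
  next
    case (lim f S)
    have int_S: "integrable M (S i)" for i using from_N[OF lim.hyps(1)] .
    have int_f: "integrable M f" using from_N[OF lim.hyps(4)] .
    show ?case
    proof (intro allI impI)
      fix e :: real assume "e > 0"
      \<comment> \<open>dominated convergence, as \<open>\<bar>S i\<bar> \<le> 2 * \<bar>f\<bar>\<close>\<close>
      have "(\<lambda>i. \<integral>x. \<bar>S i x - f x\<bar> \<partial>M) \<longlonglongrightarrow> (\<integral>x. \<bar>f x - f x\<bar> \<partial>M)"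
      proof (rule integral_dominated_convergence)
        show "AE x in M. (\<lambda>i. \<bar>S i x - f x\<bar>) \<longlonglongrightarrow> \<bar>f x - f x\<bar>"
          using lim.hyps(2) by (intro AE_I2 tendsto_intros) (auto simp: space_restr_to_subalg)
        show "AE x in M. norm \<bar>S i x - f x\<bar> \<le> 3 * \<bar>f x\<bar>" for i
        proof (rule AE_I2)
          fix x assume "x \<in> space M"
          then have "\<bar>S i x\<bar> \<le> 2 * \<bar>f x\<bar>" using lim.hyps(3)[of x i] by (simp add: space_restr_to_subalg)
          then show "norm \<bar>S i x - f x\<bar> \<le> 3 * \<bar>f x\<bar>" by simp
        qed
      qed (use int_f int_S in auto)
      then have "(\<lambda>i. \<integral>x. \<bar>S i x - f x\<bar> \<partial>M) \<longlonglongrightarrow> 0" by simp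
      from order_tendstoD(2)[OF this, of "e / 4"] \<open>e > 0\<close>
      obtain i where i: "(\<integral>x. \<bar>S i x - f x\<bar> \<partial>M) < e / 4" by (auto simp: eventually_sequentially)
      have "e / 2 > 0" using \<open>e > 0\<close> by simp
      with lim.IH[of i] have "\<forall>\<^sub>F n in sequentially. \<forall>B\<in>sets (G n s). \<bar>err B (S i)\<bar> \<le> e / 2" by blast
      then show "\<forall>\<^sub>F n in sequentially. \<forall>B\<in>sets (G n s). \<bar>err B f\<bar> \<le> e"
      proof eventually_elim
        case (elim n)
        show ?case
        proof
          fix B assume B: "B \<in> sets (G n s)"
          have int_d: "integrable M (\<lambda>x. f x - S i x)" using int_f int_S by auto
          have "err B f = err B (S i) + err B (\<lambda>x. f x - S i x)"
            using err_add[OF B_event[OF B] int_S[of i] int_d] by simp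
          moreover have "\<bar>err B (\<lambda>x. f x - S i x)\<bar> \<le> e / 2"
            using err_bound[OF B_event[OF B] int_d] i by (simp add: abs_minus_commute)
          moreover have "\<bar>err B (S i)\<bar> \<le> e / 2" using elim B by blast
          ultimately show "\<bar>err B f\<bar> \<le> e" by linarith
        qed
      qed
    qed
  qed
  with e show ?thesis unfolding err_def by blast
qed

section \<open>The Snell envelope in discrete time\<close>

text \<open>
  The witness is defined by recursion on the number \<open>k - i\<close> of remaining steps.
\<close>

lemma backward_recursion:
  fixes step :: "nat \<Rightarrow> 'b \<Rightarrow> 'b"
  shows "\<exists>U. U k = y \<and> (\<forall>i<k. U i = step i (U (Suc i)))"
proof -
  let ?V = "rec_nat y (\<lambda>j u. step (k - Suc j) u)"
  have "?V (k - i) = step i (?V (k - Suc i))" if "i < k" for i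
  proof -
    from that have "k - i = Suc (k - Suc i)" "k - Suc (k - Suc i) = i" by auto
    then show ?thesis by simp
  qed
  then show ?thesis by (intro exI[of _ "\<lambda>i. ?V (k - i)"]) simp
qed

lemma sum_lessThan_stopped:
  fixes D :: "nat \<Rightarrow> 'a \<Rightarrow> real"
  assumes "N \<omega> \<le> k" "\<omega> \<in> \<Omega>"
  shows "(\<Sum>i<N \<omega>. D i \<omega>) = (\<Sum>i<k. indicator {\<omega>\<in>\<Omega>. i < N \<omega>} \<omega> * D i \<omega>)"
proof -
  have "(\<Sum>i<k. indicator {\<omega>\<in>\<Omega>. i < N \<omega>} \<omega> * D i \<omega>) = (\<Sum>i\<in>{..<k} \<inter> {i. i < N \<omega>}. D i \<omega>)"
    using assms(2) by (auto simp: sum.inter_restrict indicator_def intro!: sum.cong)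
  also have "{..<k} \<inter> {i. i < N \<omega>} = {..<N \<omega>}" using assms(1) by auto
  finally show ?thesis by simp
qed

text \<open>
  Writing \<open>W i\<close> for the conditional expectation of \<open>U (Suc i)\<close>, the envelope satisfies
  \<open>U i = max (Y i) (W i)\<close>, so \<open>U 0 + (\<Sum>i<j. U (Suc i) - W i) = U j + (\<Sum>i<j. U i - W i)\<close> dominates
  \<open>Y j\<close>, with equality at the first time \<open>\<kappa>\<close> at which stopping is at least as good as waiting.
  The domination holds at every point, not just almost surely; this allows the index \<open>j\<close> to be
  replaced by any random index, in particular by one that is not a stopping time for \<open>H\<close>.
\<close>

lemma (in prob_space) snell_envelope:
  fixes Y :: "nat \<Rightarrow> 'a \<Rightarrow> real"
  assumes sub: "\<And>i. i \<le> k \<Longrightarrow> subalgebra M (H i)"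
    and mono: "\<And>i j. i \<le> j \<Longrightarrow> j \<le> k \<Longrightarrow> sets (H i) \<subseteq> sets (H j)"
    and Y_meas: "\<And>i. i \<le> k \<Longrightarrow> Y i \<in> borel_measurable (H i)"
    and Y_int: "\<And>i. i \<le> k \<Longrightarrow> integrable M (Y i)"
  obtains U \<kappa> where
    "\<forall>i\<le>k. U i \<in> borel_measurable (H i) \<and> integrable M (U i)"
    "\<forall>j\<le>k. \<forall>\<omega>.
      Y j \<omega> \<le> U 0 \<omega> + (\<Sum>i<j. U (Suc i) \<omega> - real_cond_exp M (H i) (U (Suc i)) \<omega>)"
    "\<forall>\<omega>. \<kappa> \<omega> \<le> k" "\<forall>i\<le>k. {\<omega>\<in>space M. \<kappa> \<omega> \<le> i} \<in> sets (H i)"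
    "(\<integral>\<omega>. U 0 \<omega> \<partial>M) = (\<integral>\<omega>. Y (\<kappa> \<omega>) \<omega> \<partial>M)"
proof -
  obtain U where U_k: "U k = Y k"
    and U_step: "\<And>i. i < k \<Longrightarrow> U i = (\<lambda>\<omega>. max (Y i \<omega>) (real_cond_exp M (H i) (U (Suc i)) \<omega>))"
    using backward_recursion[of k "Y k" "\<lambda>i u \<omega>. max (Y i \<omega>) (real_cond_exp M (H i) u \<omega>)"] by auto
  define W where "W i = real_cond_exp M (H i) (U (Suc i))" for i
  have W_meas: "W i \<in> borel_measurable (H i)" for i
    unfolding W_def by simp
  have U_eq: "U i \<omega> = max (Y i \<omega>) (W i \<omega>)" if "i < k" for i \<omega>
    using U_step[OF that] by (simp add: W_def)
  have cond_exp: "integrable M f \<Longrightarrow> integrable M (real_cond_exp M (H i) f)"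
    "integrable M f \<Longrightarrow> A \<in> sets (H i) \<Longrightarrow>
      (\<integral>\<omega>. indicator A \<omega> * f \<omega> \<partial>M) = (\<integral>\<omega>. indicator A \<omega> * real_cond_exp M (H i) f \<omega> \<partial>M)"
    if "i \<le> k" for i A and f :: "'a \<Rightarrow> real"
  proof -
    interpret Hi: finite_measure_subalgebra M "H i" using sub[OF that] by unfold_locales
    show "integrable M f \<Longrightarrow> integrable M (real_cond_exp M (H i) f)" by (rule Hi.real_cond_exp_int)
    show "(\<integral>\<omega>. indicator A \<omega> * f \<omega> \<partial>M) = (\<integral>\<omega>. indicator A \<omega> * real_cond_exp M (H i) f \<omega> \<partial>M)"
      if "integrable M f" "A \<in> sets (H i)"
      using Hi.real_cond_exp_intA[OF that] by (simp add: set_lebesgue_integral_def)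
  qed
  have U_int: "integrable M (U i)" if "i \<le> k" for i
    using that
  proof (induction i rule: inc_induct)
    case base
    then show ?case using Y_int U_k by simp
  next
    case (step i)
    then have "integrable M (W i)" unfolding W_def by (intro cond_exp) auto
    then have "integrable M (\<lambda>\<omega>. max (Y i \<omega>) (W i \<omega>))"
      using Y_int[of i] step by (intro integrable_max) auto
    then show ?case using U_eq[of i] step by simp
  qed
  have U_meas: "U i \<in> borel_measurable (H i)" if "i \<le> k" for i
  proof (cases "i < k")
    case True
    then show ?thesis
      using Y_meas[OF that] W_meas[of i] by (subst U_step) (auto simp: W_def[symmetric])
  next
    case False
    with that U_k Y_meas show ?thesis by simp
  qed
  define D where "D i \<omega> = U (Suc i) \<omega> - W i \<omega>" for i \<omega>
  have doob: "U 0 \<omega> + (\<Sum>i<j. D i \<omega>) = U j \<omega> + (\<Sum>i<j. U i \<omega> - W i \<omega>)" for j \<omega>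
    by (induction j) (simp_all add: D_def)
  have U_ge: "Y i \<omega> \<le> U i \<omega>" if "i \<le> k" for i \<omega>
    using that U_k U_eq[of i \<omega>] by (cases "i < k") auto
  \<comment> \<open>the alternative \<open>k \<le> i\<close> forces a stop at the end\<close>
  define \<kappa> where "\<kappa> \<omega> = (LEAST i. k \<le> i \<or> W i \<omega> \<le> Y i \<omega>)" for \<omega>
  have \<kappa>_le: "\<kappa> \<omega> \<le> k" for \<omega> unfolding \<kappa>_def by (rule Least_le) simp
  have \<kappa>_stop: "k \<le> \<kappa> \<omega> \<or> W (\<kappa> \<omega>) \<omega> \<le> Y (\<kappa> \<omega>) \<omega>" for \<omega>
    unfolding \<kappa>_def by (rule LeastI[of _ k]) simp
  have \<kappa>_iff: "\<kappa> \<omega> \<le> i \<longleftrightarrow> k \<le> i \<or> (\<exists>j\<le>i. W j \<omega> \<le> Y j \<omega>)" for \<omega> i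
  proof
    assume "\<kappa> \<omega> \<le> i"
    with \<kappa>_stop[of \<omega>] show "k \<le> i \<or> (\<exists>j\<le>i. W j \<omega> \<le> Y j \<omega>)" by auto
  next
    assume "k \<le> i \<or> (\<exists>j\<le>i. W j \<omega> \<le> Y j \<omega>)"
    then obtain j where "j \<le> i" "k \<le> j \<or> W j \<omega> \<le> Y j \<omega>" by auto
    moreover from this(2) have "\<kappa> \<omega> \<le> j" unfolding \<kappa>_def by (rule Least_le)
    ultimately show "\<kappa> \<omega> \<le> i" by simp
  qed
  have \<kappa>_stopping: "{\<omega>\<in>space M. \<kappa> \<omega> \<le> i} \<in> sets (H i)" if "i \<le> k" for i
  proof (cases "i = k")
    case True
    then have "{\<omega>\<in>space M. \<kappa> \<omega> \<le> i} = space (H i)"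
      using \<kappa>_le sub[OF that] by (auto simp: subalgebra_def)
    then show ?thesis by simp
  next
    case False
    have "{\<omega>\<in>space M. W j \<omega> \<le> Y j \<omega>} \<in> sets (H i)" if "j \<le> i" for j
    proof -
      have [measurable]: "Y j \<in> borel_measurable (H j)" "W j \<in> borel_measurable (H j)"
        using Y_meas[of j] W_meas[of j] that \<open>i \<le> k\<close> by auto
      have "{\<omega>\<in>space (H j). W j \<omega> \<le> Y j \<omega>} \<in> sets (H j)" by measurable
      also have "space (H j) = space M" using sub[of j] that \<open>i \<le> k\<close> by (simp add: subalgebra_def)
      finally show ?thesis using mono[OF that \<open>i \<le> k\<close>] by blast
    qed
    moreover have "{\<omega>\<in>space M. \<kappa> \<omega> \<le> i} = (\<Union>j\<le>i. {\<omega>\<in>space M. W j \<omega> \<le> Y j \<omega>})"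
      using False that by (auto simp: \<kappa>_iff)
    ultimately show ?thesis by auto
  qed
  have U_\<kappa>: "Y (\<kappa> \<omega>) \<omega> = U 0 \<omega> + (\<Sum>i<\<kappa> \<omega>. D i \<omega>)" for \<omega>
  proof -
    have "U i \<omega> = W i \<omega>" if "i < \<kappa> \<omega>" for i
    proof -
      have "\<not> \<kappa> \<omega> \<le> i" using that by simp
      then have "i < k" "Y i \<omega> < W i \<omega>" unfolding \<kappa>_iff by (auto simp: not_le)
      then show ?thesis using U_eq by simp
    qed
    then have "(\<Sum>i<\<kappa> \<omega>. U i \<omega> - W i \<omega>) = 0" by simp
    moreover have "U (\<kappa> \<omega>) \<omega> = Y (\<kappa> \<omega>) \<omega>"
      using \<kappa>_stop[of \<omega>] \<kappa>_le[of \<omega>] U_k U_eq[of "\<kappa> \<omega>" \<omega>]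
      by (cases "\<kappa> \<omega> < k") auto
    ultimately show ?thesis using doob[of \<omega> "\<kappa> \<omega>"] by simp
  qed
  have D_int: "integrable M (\<lambda>\<omega>. indicator {\<omega>\<in>space M. i < \<kappa> \<omega>} \<omega> * D i \<omega>)"
    and D_zero: "(\<integral>\<omega>. indicator {\<omega>\<in>space M. i < \<kappa> \<omega>} \<omega> * D i \<omega> \<partial>M) = 0" if "i < k" for i
  proof -
    let ?A = "{\<omega>\<in>space M. i < \<kappa> \<omega>}"
    have "space (H i) - {\<omega>\<in>space M. \<kappa> \<omega> \<le> i} \<in> sets (H i)"
      using \<kappa>_stopping[of i] that by auto
    moreover have "space (H i) - {\<omega>\<in>space M. \<kappa> \<omega> \<le> i} = ?A"
      using sub[of i] that by (auto simp: subalgebra_def)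
    ultimately have A: "?A \<in> sets (H i)" by simp
    then have "?A \<in> events" using sub[of i] that by (auto simp: subalgebra_def)
    then have int_mult: "integrable M (\<lambda>\<omega>. indicator ?A \<omega> * f \<omega>)" if "integrable M f" for f :: "'a \<Rightarrow> real"
      using integrable_mult_indicator[of ?A M f] that by simp
    have int_U: "integrable M (U (Suc i))" using U_int that by simp
    then have int_W: "integrable M (W i)" unfolding W_def using cond_exp(1) that by simp
    have "(\<integral>\<omega>. indicator ?A \<omega> * D i \<omega> \<partial>M)
        = (\<integral>\<omega>. indicator ?A \<omega> * U (Suc i) \<omega> \<partial>M) - (\<integral>\<omega>. indicator ?A \<omega> * W i \<omega> \<partial>M)"
      unfolding D_def right_diff_distrib
      using int_U int_W by (intro Bochner_Integration.integral_diff int_mult)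
    also have "\<dots> = 0" using cond_exp(2)[OF _ int_U A] that by (simp add: W_def)
    finally show "(\<integral>\<omega>. indicator ?A \<omega> * D i \<omega> \<partial>M) = 0" .
    show "integrable M (\<lambda>\<omega>. indicator ?A \<omega> * D i \<omega>)"
      using int_U int_W by (auto simp: D_def intro!: int_mult)
  qed
  have "(\<integral>\<omega>. Y (\<kappa> \<omega>) \<omega> \<partial>M)
      = (\<integral>\<omega>. U 0 \<omega> + (\<Sum>i<k. indicator {\<omega>\<in>space M. i < \<kappa> \<omega>} \<omega> * D i \<omega>) \<partial>M)"
    unfolding U_\<kappa>
    by (intro Bochner_Integration.integral_cong refl) (simp only: sum_lessThan_stopped[of \<kappa>, OF \<kappa>_le])
  also have "\<dots> = (\<integral>\<omega>. U 0 \<omega> \<partial>M) + (\<integral>\<omega>. (\<Sum>i<k. indicator {\<omega>\<in>space M. i < \<kappa> \<omega>} \<omega> * D i \<omega>) \<partial>M)"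
    using U_int[of 0] D_int by (intro Bochner_Integration.integral_add Bochner_Integration.integrable_sum) simp_all
  also have "(\<integral>\<omega>. (\<Sum>i<k. indicator {\<omega>\<in>space M. i < \<kappa> \<omega>} \<omega> * D i \<omega>) \<partial>M)
      = (\<Sum>i<k. \<integral>\<omega>. indicator {\<omega>\<in>space M. i < \<kappa> \<omega>} \<omega> * D i \<omega> \<partial>M)"
    using D_int by (intro Bochner_Integration.integral_sum) simp_all
  also have "\<dots> = 0" using D_zero by (intro sum.neutral) simp
  finally have value_\<kappa>: "(\<integral>\<omega>. U 0 \<omega> \<partial>M) = (\<integral>\<omega>. Y (\<kappa> \<omega>) \<omega> \<partial>M)" by simp
  show ?thesis
  proof (rule that[of U \<kappa>]; (intro allI impI conjI)?)
    fix j \<omega> assume j: "j \<le> k"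
    have "0 \<le> (\<Sum>i<j. U i \<omega> - W i \<omega>)" using j U_eq by (intro sum_nonneg) auto
    then show "Y j \<omega> \<le> U 0 \<omega> + (\<Sum>i<j. U (Suc i) \<omega> - real_cond_exp M (H i) (U (Suc i)) \<omega>)"
      using U_ge[OF j, of \<omega>] doob[of \<omega> j] by (simp add: D_def W_def)
  qed (simp_all add: U_meas U_int \<kappa>_le \<kappa>_stopping value_\<kappa>)
qed

section \<open>Stopping times\<close>

text \<open>
  The instance \<open>h = 0\<close> turns a discrete stopping time into one in continuous time; positive \<open>h\<close> gives
  the lagged times that are compared with \<open>\<tau>\<close> in Aldous' criterion.
\<close>

lemma stopping_time_grid:
  fixes F :: "real \<Rightarrow> 'a measure" and t :: "nat \<Rightarrow> real"
  assumes space: "\<And>s. space (F s) = \<Omega>"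
    and mono: "\<And>r s. r \<le> s \<Longrightarrow> sets (F r) \<subseteq> sets (F s)"
    and t: "mono t" and h: "0 \<le> h"
    and N: "\<And>\<omega>. \<omega> \<in> \<Omega> \<Longrightarrow> N \<omega> \<le> k" "\<And>j. j \<le> k \<Longrightarrow> {\<omega>\<in>\<Omega>. N \<omega> \<le> j} \<in> sets (F (t j))"
  shows "stopping_time F (\<lambda>\<omega>. min T (t (N \<omega>) + h))"
proof (rule stopping_timeI)
  fix s
  show "Measurable.pred (F s) (\<lambda>\<omega>. min T (t (N \<omega>) + h) \<le> s)"
  proof (cases "T \<le> s")
    case True
    then show ?thesis by (simp add: min_le_iff_disj)
  next
    case False
    have "{\<omega>\<in>\<Omega>. min T (t (N \<omega>) + h) \<le> s} = (\<Union>j\<in>{j. j \<le> k \<and> t j + h \<le> s}. {\<omega>\<in>\<Omega>. N \<omega> \<le> j})"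
    proof (intro set_eqI iffI)
      fix \<omega> assume "\<omega> \<in> {\<omega>\<in>\<Omega>. min T (t (N \<omega>) + h) \<le> s}"
      then show "\<omega> \<in> (\<Union>j\<in>{j. j \<le> k \<and> t j + h \<le> s}. {\<omega>\<in>\<Omega>. N \<omega> \<le> j})"
        using False N(1)[of \<omega>] by (auto simp: min_le_iff_disj intro!: bexI[of _ "N \<omega>"])
    next
      fix \<omega> assume "\<omega> \<in> (\<Union>j\<in>{j. j \<le> k \<and> t j + h \<le> s}. {\<omega>\<in>\<Omega>. N \<omega> \<le> j})"
      then obtain j where "\<omega> \<in> \<Omega>" "N \<omega> \<le> j" "t j + h \<le> s" by auto
      then show "\<omega> \<in> {\<omega>\<in>\<Omega>. min T (t (N \<omega>) + h) \<le> s}"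
        using monoD[OF t, of "N \<omega>" j] by (auto simp: min_le_iff_disj)
    qed
    moreover have "{\<omega>\<in>\<Omega>. N \<omega> \<le> j} \<in> sets (F s)" if "j \<le> k" "t j + h \<le> s" for j
      using N(2)[OF that(1)] mono[of "t j" s] that(2) h by auto
    ultimately show ?thesis
      unfolding pred_def space by (auto intro!: sets.finite_UN finite_subset[of _ "{..k}"])
  qed
qed

text \<open>
  Only the times up to \<open>T\<close> may be used here: after \<open>T\<close> a natural filtration need not be contained in
  \<open>M\<close>.
\<close>

lemma borel_measurable_stopping_times:
  assumes sub: "\<And>t. t \<le> T \<Longrightarrow> subalgebra M (F t)" and \<tau>: "\<tau> \<in> stopping_times M T F"
  shows "\<tau> \<in> borel_measurable M"
proof (rule borel_measurableI_le)
  fix t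
  show "{\<omega>\<in>space M. \<tau> \<omega> \<le> t} \<in> sets M"
  proof (cases "t \<le> T")
    case True
    have "{\<omega>\<in>space (F t). \<tau> \<omega> \<le> t} \<in> sets (F t)"
      using \<tau> unfolding stopping_times_def by (auto dest!: stopping_timeD[of _ _ t] simp: pred_def)
    then show ?thesis using sub[OF True] by (auto simp: subalgebra_def)
  next
    case False
    then have "{\<omega>\<in>space M. \<tau> \<omega> \<le> t} = space M" using \<tau> by (auto simp: stopping_times_def)
    then show ?thesis by simp
  qed
qed

section \<open>Rewards\<close>

text \<open>
  Cutting times off to \<open>{0..T}\<close> extends \<open>\<gamma>\<close> continuously to the whole plane.
\<close>

lemma borel_measurable_reward:
  fixes \<gamma> :: "real \<times> real \<Rightarrow> real"
  assumes cont: "continuous_on ({0..T} \<times> UNIV) \<gamma>" and T: "0 \<le> T"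
    and [measurable]: "\<tau> \<in> borel_measurable M" "Z \<in> borel_measurable M"
    and range: "\<And>\<omega>. \<omega> \<in> space M \<Longrightarrow> \<tau> \<omega> \<in> {0..T}"
  shows "(\<lambda>\<omega>. \<gamma> (\<tau> \<omega>, Z \<omega>)) \<in> borel_measurable M"
proof -
  let ?g = "\<lambda>p::real \<times> real. \<gamma> (max 0 (min T (fst p)), snd p)"
  have "continuous_on UNIV ?g"
    by (rule continuous_on_compose2[OF cont]) (use T in \<open>auto intro!: continuous_intros\<close>)
  then have [measurable]: "?g \<in> borel_measurable borel" by (rule borel_measurable_continuous_onI)
  have "(\<lambda>\<omega>. ?g (\<tau> \<omega>, Z \<omega>)) \<in> borel_measurable M" by measurable
  then show ?thesis using range by (subst measurable_cong[where g = "\<lambda>\<omega>. ?g (\<tau> \<omega>, Z \<omega>)"]) auto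
qed

lemma reward_modulus:
  fixes \<gamma> :: "real \<times> real \<Rightarrow> real"
  assumes cont: "continuous_on ({0..T} \<times> UNIV) \<gamma>" and e: "e > 0"
  obtains d where "d > 0" "\<And>s t x y. s \<in> {0..T} \<Longrightarrow> t \<in> {0..T} \<Longrightarrow> \<bar>s - t\<bar> < d \<Longrightarrow> \<bar>x - y\<bar> < d \<Longrightarrow>
    \<bar>y\<bar> \<le> K \<Longrightarrow> \<bar>\<gamma> (s, x) - \<gamma> (t, y)\<bar> < e"
proof -
  let ?S = "{0..T} \<times> {-(K+1)..K+1}"
  have "uniformly_continuous_on ?S \<gamma>"
    by (intro compact_uniformly_continuous continuous_on_subset[OF cont] compact_Times) auto
  then obtain d where d: "d > 0" "\<And>p q. p \<in> ?S \<Longrightarrow> q \<in> ?S \<Longrightarrow> dist p q < d \<Longrightarrow> dist (\<gamma> p) (\<gamma> q) < e"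
    using e unfolding uniformly_continuous_on_def by metis
  show ?thesis
  proof (rule that[of "min 1 (d / 2)"])
    fix s t x y :: real
    assume *: "s \<in> {0..T}" "t \<in> {0..T}" "\<bar>s - t\<bar> < min 1 (d / 2)" "\<bar>x - y\<bar> < min 1 (d / 2)" "\<bar>y\<bar> \<le> K"
    have "dist (s, x) (t, y) \<le> \<bar>s - t\<bar> + \<bar>x - y\<bar>"
      using sqrt_sum_squares_le_sum_abs[of "s - t" "x - y"] by (simp add: dist_Pair_Pair dist_real_def)
    also have "\<dots> < d" using * by auto
    finally have "dist (s, x) (t, y) < d" .
    moreover have "x \<in> {-(K+1)..K+1}" "y \<in> {-(K+1)..K+1}" using *(4,5) by auto
    then have "(s, x) \<in> ?S" "(t, y) \<in> ?S" using *(1,2) by blast+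
    ultimately have "dist (\<gamma> (s, x)) (\<gamma> (t, y)) < e" by (intro d(2))
    then show "\<bar>\<gamma> (s, x) - \<gamma> (t, y)\<bar> < e" by (simp add: dist_real_def)
  qed (use d(1) in simp)
qed

lemma (in prob_space) integrable_reward_at:
  fixes \<gamma> :: "real \<times> real \<Rightarrow> real"
  assumes cont: "continuous_on ({0..T} \<times> UNIV) \<gamma>" and T: "0 \<le> T"
    and bdd: "\<And>t x. t \<in> {0..T} \<Longrightarrow> \<bar>\<gamma> (t, x)\<bar> \<le> C"
    and Y: "cadlag_process M T Y" and \<tau>: "\<tau> \<in> borel_measurable M"
    and range: "\<And>\<omega>. \<omega> \<in> space M \<Longrightarrow> \<tau> \<omega> \<in> {0..T}"
  shows "integrable M (\<lambda>\<omega>. \<gamma> (\<tau> \<omega>, Y (\<tau> \<omega>) \<omega>))"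
proof (rule integrable_const_bound)
  show "(\<lambda>\<omega>. \<gamma> (\<tau> \<omega>, Y (\<tau> \<omega>) \<omega>)) \<in> borel_measurable M"
    using borel_measurable_cadlag_process_at[OF Y T \<tau> range]
    by (intro borel_measurable_reward[OF cont T \<tau>] range)
  show "AE \<omega> in M. norm (\<gamma> (\<tau> \<omega>, Y (\<tau> \<omega>) \<omega>)) \<le> C"
    using bdd range by (intro AE_I2) simp
qed

section \<open>Rounding stopping times to a grid\<close>

definition grid :: "real \<Rightarrow> nat \<Rightarrow> nat \<Rightarrow> real" where
  "grid T k j = real j * T / real k"

text \<open>
  Rounding up, not to the nearest grid point, is what keeps the rounded time a stopping time.
\<close>

definition grid_index :: "real \<Rightarrow> nat \<Rightarrow> real \<Rightarrow> nat" where
  "grid_index T k s = nat \<lceil>s * real k / T\<rceil>"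

context
  fixes T :: real and k :: nat
  assumes T: "T > 0" and k: "k > 0"
begin

lemma grid_mem: "j \<le> k \<Longrightarrow> grid T k j \<in> {0..T}"
  using T k by (auto simp: grid_def field_simps)

lemma grid_less: "j < k \<Longrightarrow> grid T k j < T"
  using T k by (auto simp: grid_def field_simps)

lemma mono_grid: "mono (grid T k)"
  using T k by (auto simp: grid_def intro!: monoI divide_right_mono mult_right_mono)

lemma grid_index_le_iff: "grid_index T k s \<le> j \<longleftrightarrow> s \<le> grid T k j"
proof -
  have "grid_index T k s \<le> j \<longleftrightarrow> s * real k / T \<le> real j"
    by (simp add: grid_index_def nat_le_iff ceiling_le_iff)
  also have "\<dots> \<longleftrightarrow> s \<le> grid T k j" using T k by (simp add: grid_def field_simps)
  finally show ?thesis .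
qed

lemma grid_index_le: "s \<le> T \<Longrightarrow> grid_index T k s \<le> k"
  using k by (simp add: grid_index_le_iff) (simp add: grid_def)

lemma le_grid_index: "s \<le> grid T k (grid_index T k s)"
  using grid_index_le_iff[of s "grid_index T k s"] by simp

lemma grid_index_less:
  assumes "0 \<le> s"
  shows "grid T k (grid_index T k s) < s + T / real k"
proof -
  have "0 \<le> s * real k / T" using assms T by simp
  then have "0 \<le> \<lceil>s * real k / T\<rceil>" by linarith
  then have "real (grid_index T k s) < s * real k / T + 1"
    unfolding grid_index_def by (simp add: of_nat_nat) linarith
  then have "real (grid_index T k s) * T < (s * real k / T + 1) * T" using T by simp
  also have "\<dots> = s * real k + T" using T by (simp add: field_simps)
  finally show ?thesis using k by (simp add: grid_def field_simps)
qed

end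

lemma natural_stopping_time_at_grid:
  assumes Y: "\<tau> \<in> stopping_times M T (natural_filtration M Y)" and T: "T > 0" and k: "k > 0"
  shows "\<And>j. {\<omega>\<in>space M. grid_index T k (\<tau> \<omega>) \<le> j} \<in> sets (natural_filtration M Y (grid T k j))"
    and "\<And>\<omega>. \<omega> \<in> space M \<Longrightarrow> grid_index T k (\<tau> \<omega>) \<le> k"
    and "\<And>\<omega>. \<omega> \<in> space M \<Longrightarrow> \<tau> \<omega> \<in> {0..T}"
proof -
  have \<tau>: "stopping_time (natural_filtration M Y) \<tau>" "\<And>\<omega>. \<omega> \<in> space M \<Longrightarrow> \<tau> \<omega> \<in> {0..T}"
    using Y by (auto simp: stopping_times_def)
  show "{\<omega>\<in>space M. grid_index T k (\<tau> \<omega>) \<le> j} \<in> sets (natural_filtration M Y (grid T k j))" for j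
    using stopping_timeD[OF \<tau>(1), of "grid T k j"] by (simp add: pred_def grid_index_le_iff[OF T k])
  show "\<And>\<omega>. \<omega> \<in> space M \<Longrightarrow> \<tau> \<omega> \<in> {0..T}" by (rule \<tau>(2))
  show "grid_index T k (\<tau> \<omega>) \<le> k" if "\<omega> \<in> space M" for \<omega>
    using \<tau>(2)[OF that] by (intro grid_index_le[OF T k]) auto
qed

lemma borel_measurable_grid_index:
  assumes [measurable]: "\<tau> \<in> borel_measurable M"
  shows "(\<lambda>\<omega>. grid T k (grid_index T k (\<tau> \<omega>))) \<in> borel_measurable M"
  unfolding grid_def grid_index_def by measurable

section \<open>Values of the optimal stopping problems\<close>

text \<open>
  For a fixed grid, the value of \<open>X\<close> at the rounded time is a reward collected by an agent who
  observes \<open>Xn n\<close> instead of \<open>X\<close>.  The Doob decomposition of the Snell envelope bounds the gain from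
  this other information by the correlation of the martingale increments with events known from
  \<open>Xn n\<close>, which vanishes in the limit.
\<close>

lemma (in prob_space) discrete_optimal_value_bound:
  fixes \<gamma> :: "real \<times> real \<Rightarrow> real"
  assumes T: "T > 0" and k: "k > 0"
    and X: "cadlag_process M T X" and Xn: "\<And>n. cadlag_process M T (Xn n)"
    and cont: "continuous_on ({0..T} \<times> UNIV) \<gamma>"
    and bdd: "\<And>t x. t \<in> {0..T} \<Longrightarrow> \<bar>\<gamma> (t, x)\<bar> \<le> C"
    and filt: "weak_filtration_conv M T (\<lambda>n. natural_filtration M (Xn n)) (right_cont_filtration M T X)"
    and e: "e > 0"
  shows "\<forall>\<^sub>F n in sequentially. \<forall>\<tau>\<in>stopping_times M T (natural_filtration M (Xn n)).
    (\<integral>\<omega>. \<gamma> (grid T k (grid_index T k (\<tau> \<omega>)), X (grid T k (grid_index T k (\<tau> \<omega>))) \<omega>) \<partial>M)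
      \<le> optimal_value M T (right_cont_filtration M T X) \<gamma> X + e"
proof -
  let ?F = "right_cont_filtration M T X"
  let ?t = "grid T k"
  define Y where "Y j \<omega> = \<gamma> (?t j, X (?t j) \<omega>)" for j \<omega>
  have subF: "subalgebra M (?F t)" for t using subalgebra_right_cont_filtration[OF X] .
  have Y_meas: "Y j \<in> borel_measurable (?F (?t j))" if "j \<le> k" for j
    unfolding Y_def
  proof (rule borel_measurable_reward[OF cont less_imp_le[OF T]])
    have t: "?t j \<in> {0..T}" using grid_mem[OF T k that] .
    then have "X (?t j) \<in> borel_measurable (natural_filtration M X (?t j))"
      by (intro borel_measurable_natural_filtration) auto
    then show "X (?t j) \<in> borel_measurable (?F (?t j))"
      using natural_filtration_subset_right_cont_filtration[of "?t j" T M X] t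
      by (auto simp: measurable_def)
  qed (use grid_mem[OF T k that] in auto)
  have Y_bdd: "\<bar>Y j \<omega>\<bar> \<le> C" if "j \<le> k" for j \<omega>
    unfolding Y_def using grid_mem[OF T k that] by (rule bdd)
  have Y_int: "integrable M (Y j)" if "j \<le> k" for j
    using measurable_from_subalg[OF subF Y_meas[OF that]] Y_bdd[OF that]
    by (intro integrable_const_bound[of _ C]) auto
  have F_mono: "sets (?F (?t i)) \<subseteq> sets (?F (?t j))" if "i \<le> j" "j \<le> k" for i j
    using monoD[OF mono_grid[OF T k] that(1)] by (rule right_cont_filtration_mono)
  obtain U \<kappa> where U: "\<forall>i\<le>k. U i \<in> borel_measurable (?F (?t i)) \<and> integrable M (U i)"
    and U_dom: "\<forall>j\<le>k. \<forall>\<omega>.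
      Y j \<omega> \<le> U 0 \<omega> + (\<Sum>i<j. U (Suc i) \<omega> - real_cond_exp M (?F (?t i)) (U (Suc i)) \<omega>)"
    and \<kappa>: "\<forall>\<omega>. \<kappa> \<omega> \<le> k" "\<forall>i\<le>k. {\<omega>\<in>space M. \<kappa> \<omega> \<le> i} \<in> sets (?F (?t i))"
    and U_0: "(\<integral>\<omega>. U 0 \<omega> \<partial>M) = (\<integral>\<omega>. Y (\<kappa> \<omega>) \<omega> \<partial>M)"
    by (rule snell_envelope[of k "\<lambda>i. ?F (?t i)" Y, OF subF F_mono Y_meas Y_int])
  note U_meas = U[THEN spec, THEN mp, THEN conjunct1] and U_int = U[THEN spec, THEN mp, THEN conjunct2]
    and \<kappa>_le = \<kappa>(1)[THEN spec]
  have U_0_le: "(\<integral>\<omega>. U 0 \<omega> \<partial>M) \<le> optimal_value M T ?F \<gamma> X"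
  proof -
    have "?t (\<kappa> \<omega>) \<in> {0..T}" for \<omega> using grid_mem[OF T k \<kappa>_le] .
    then have min: "min T (?t (\<kappa> \<omega>) + 0) = ?t (\<kappa> \<omega>)" for \<omega> by (simp add: min_absorb2)
    have "stopping_time ?F (\<lambda>\<omega>. min T (?t (\<kappa> \<omega>) + 0))"
      by (rule stopping_time_grid[where \<Omega> = "space M" and k = k])
        (use mono_grid[OF T k] \<kappa> in \<open>auto intro: right_cont_filtration_mono[THEN subsetD]\<close>)
    then have "(\<lambda>\<omega>. ?t (\<kappa> \<omega>)) \<in> stopping_times M T ?F"
      using grid_mem[OF T k \<kappa>_le] unfolding min by (auto simp: stopping_times_def)
    moreover have "bdd_above ((\<lambda>\<tau>. \<integral>\<omega>. \<gamma> (\<tau> \<omega>, X (\<tau> \<omega>) \<omega>) \<partial>M) ` stopping_times M T ?F)"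
    proof (rule bdd_aboveI2)
      fix \<tau> assume \<tau>: "\<tau> \<in> stopping_times M T ?F"
      then have range: "\<And>\<omega>. \<omega> \<in> space M \<Longrightarrow> \<tau> \<omega> \<in> {0..T}" by (auto simp: stopping_times_def)
      have "\<tau> \<in> borel_measurable M" by (rule borel_measurable_stopping_times[OF subF \<tau>])
      then have "(\<integral>\<omega>. \<gamma> (\<tau> \<omega>, X (\<tau> \<omega>) \<omega>) \<partial>M) \<le> (\<integral>\<omega>. C \<partial>M)"
        using bdd range
        by (intro integral_mono integrable_reward_at[OF cont less_imp_le[OF T] bdd X])
          (auto intro: order_trans[OF abs_ge_self])
      then show "(\<integral>\<omega>. \<gamma> (\<tau> \<omega>, X (\<tau> \<omega>) \<omega>) \<partial>M) \<le> C" by (simp add: prob_space)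
    qed
    ultimately have "(\<integral>\<omega>. \<gamma> (?t (\<kappa> \<omega>), X (?t (\<kappa> \<omega>)) \<omega>) \<partial>M) \<le> optimal_value M T ?F \<gamma> X"
      unfolding optimal_value_def by (rule cSUP_upper[where f = "\<lambda>\<tau>. \<integral>\<omega>. \<gamma> (\<tau> \<omega>, X (\<tau> \<omega>) \<omega>) \<partial>M"])
    then show ?thesis by (simp add: U_0 Y_def)
  qed
  define D where "D i \<omega> = U (Suc i) \<omega> - real_cond_exp M (?F (?t i)) (U (Suc i)) \<omega>" for i \<omega>
  have D_int: "integrable M (D i)" if "i < k" for i
  proof -
    interpret Fi: finite_measure_subalgebra M "?F (?t i)" using subF by unfold_locales
    show ?thesis unfolding D_def using that U_int[of "Suc i"]
      by (intro Bochner_Integration.integrable_diff Fi.real_cond_exp_int) auto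
  qed
  have "\<forall>i\<in>{..<k}. \<forall>\<^sub>F n in sequentially. \<forall>B\<in>sets (natural_filtration M (Xn n) (?t i)).
      \<bar>\<integral>\<omega>. indicator B \<omega> * D i \<omega> \<partial>M\<bar> \<le> e / real k"
  proof
    fix i assume "i \<in> {..<k}"
    then have i: "i < k" by simp
    have "U (Suc i) \<in> borel_measurable (?F T)"
      using U_meas[of "Suc i"] i right_cont_filtration_mono[of "?t (Suc i)" T M T X] grid_mem[OF T k, of "Suc i"]
      by (auto simp: measurable_def)
    then show "\<forall>\<^sub>F n in sequentially. \<forall>B\<in>sets (natural_filtration M (Xn n) (?t i)).
      \<bar>\<integral>\<omega>. indicator B \<omega> * D i \<omega> \<partial>M\<bar> \<le> e / real k"
      unfolding D_def using U_int[of "Suc i"] i k e grid_mem[OF T k, of i] grid_less[OF T k i]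
      by (intro weak_filtration_conv_integrable[where F = ?F and T = T] filt subF
          subalgebra_natural_filtration[OF Xn] natural_filtration_mono) auto
  qed
  then have "\<forall>\<^sub>F n in sequentially. \<forall>i\<in>{..<k}. \<forall>B\<in>sets (natural_filtration M (Xn n) (?t i)).
      \<bar>\<integral>\<omega>. indicator B \<omega> * D i \<omega> \<partial>M\<bar> \<le> e / real k"
    by (intro eventually_ball_finite) auto
  then show ?thesis
  proof eventually_elim
    case (elim n)
    show ?case
    proof
      fix \<tau> assume \<tau>: "\<tau> \<in> stopping_times M T (natural_filtration M (Xn n))"
      define N where "N \<omega> = grid_index T k (\<tau> \<omega>)" for \<omega>
      note N = natural_stopping_time_at_grid[OF \<tau> T k, folded N_def]
      have N_sub: "subalgebra M (natural_filtration M (Xn n) (?t j))" if "j \<le> k" for j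
        using grid_mem[OF T k that] by (intro subalgebra_natural_filtration[OF Xn]) auto
      have N_gt: "{\<omega>\<in>space M. i < N \<omega>} \<in> sets (natural_filtration M (Xn n) (?t i))" for i
      proof -
        have "{\<omega>\<in>space M. i < N \<omega>} = space (natural_filtration M (Xn n) (?t i)) - {\<omega>\<in>space M. N \<omega> \<le> i}" by auto
        also have "\<dots> \<in> sets (natural_filtration M (Xn n) (?t i))" using N(1)[of i] by (rule sets.compl_sets)
        finally show ?thesis .
      qed
      have N_gt_event: "{\<omega>\<in>space M. i < N \<omega>} \<in> events" if "i < k" for i
        using N_gt[of i] N_sub[of i] that by (auto simp: subalgebra_def)
      have int_D: "integrable M (\<lambda>\<omega>. indicator {\<omega>\<in>space M. i < N \<omega>} \<omega> * D i \<omega>)" if "i < k" for i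
        using integrable_mult_indicator[OF N_gt_event[OF that] D_int[OF that]] by simp
      have "(\<integral>\<omega>. Y (N \<omega>) \<omega> \<partial>M)
          \<le> (\<integral>\<omega>. U 0 \<omega> + (\<Sum>i<k. indicator {\<omega>\<in>space M. i < N \<omega>} \<omega> * D i \<omega>) \<partial>M)"
      proof (rule integral_mono)
        have "\<tau> \<in> borel_measurable M"
          by (rule borel_measurable_stopping_times[OF subalgebra_natural_filtration[OF Xn] \<tau>])
        then have "(\<lambda>\<omega>. ?t (N \<omega>)) \<in> borel_measurable M"
          unfolding N_def by (rule borel_measurable_grid_index)
        then show "integrable M (\<lambda>\<omega>. Y (N \<omega>) \<omega>)"
          unfolding Y_def using N(2) grid_mem[OF T k]
          by (intro integrable_reward_at[OF cont less_imp_le[OF T] bdd X]) auto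
        show "integrable M (\<lambda>\<omega>. U 0 \<omega> + (\<Sum>i<k. indicator {\<omega>\<in>space M. i < N \<omega>} \<omega> * D i \<omega>))"
          using U_int[of 0] int_D
          by (intro Bochner_Integration.integrable_add Bochner_Integration.integrable_sum) auto
        fix \<omega> assume \<omega>: "\<omega> \<in> space M"
        show "Y (N \<omega>) \<omega> \<le> U 0 \<omega> + (\<Sum>i<k. indicator {\<omega>\<in>space M. i < N \<omega>} \<omega> * D i \<omega>)"
          unfolding sum_lessThan_stopped[of N, OF N(2)[OF \<omega>] \<omega>, of D, symmetric]
          using U_dom N(2)[OF \<omega>] by (simp add: D_def)
      qed
      also have "\<dots> = (\<integral>\<omega>. U 0 \<omega> \<partial>M) + (\<integral>\<omega>. (\<Sum>i<k. indicator {\<omega>\<in>space M. i < N \<omega>} \<omega> * D i \<omega>) \<partial>M)"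
        using U_int[of 0] int_D by (intro Bochner_Integration.integral_add Bochner_Integration.integrable_sum) auto
      also have "(\<integral>\<omega>. (\<Sum>i<k. indicator {\<omega>\<in>space M. i < N \<omega>} \<omega> * D i \<omega>) \<partial>M)
          = (\<Sum>i<k. \<integral>\<omega>. indicator {\<omega>\<in>space M. i < N \<omega>} \<omega> * D i \<omega> \<partial>M)"
        using int_D by (intro Bochner_Integration.integral_sum) auto
      also have "\<dots> \<le> (\<Sum>i<k. e / real k)"
        using elim N_gt by (intro sum_mono) (auto intro: order_trans[OF abs_ge_self])
      also have "\<dots> = e" using k by simp
      finally have "(\<integral>\<omega>. Y (N \<omega>) \<omega> \<partial>M) \<le> (\<integral>\<omega>. U 0 \<omega> \<partial>M) + e" by simp
      with U_0_le show "(\<integral>\<omega>. \<gamma> (grid T k (grid_index T k (\<tau> \<omega>)),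
          X (grid T k (grid_index T k (\<tau> \<omega>))) \<omega>) \<partial>M) \<le> optimal_value M T ?F \<gamma> X + e"
        by (simp add: Y_def N_def)
    qed
  qed
qed

text \<open>
  Outside an event \<open>B\<close> of probability at most \<open>3 * \<eta>\<close>, three things hold: the path of \<open>X\<close> is bounded
  by \<open>K\<close> on the grid (this fails on \<open>B1\<close>), \<open>Xn n\<close> moves by less than \<open>d / 2\<close> between \<open>\<tau>\<close> and the lagged
  rounded time \<open>\<nu>\<close> (this fails on \<open>B2\<close>), and \<open>Xn n\<close> at \<open>\<nu>\<close> is close to \<open>X\<close> at the grid point (this
  fails on one of the \<open>B3 j\<close>).  There uniform continuity of \<open>\<gamma>\<close> on a compact
  set applies.  The bound \<open>K\<close> has to be found before the grid, since the mesh depends on it.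
\<close>

lemma (in prob_space) stopped_reward_le_grid:
  fixes \<gamma> :: "real \<times> real \<Rightarrow> real"
  assumes T: "T > 0"
    and X: "cadlag_process M T X" and Xn: "\<And>n. cadlag_process M T (Xn n)"
    and cont: "continuous_on ({0..T} \<times> UNIV) \<gamma>"
    and bdd: "\<And>t x. t \<in> {0..T} \<Longrightarrow> \<bar>\<gamma> (t, x)\<bar> \<le> C"
    and conv: "skorokhod_conv_in_prob M T Xn X"
    and aldous: "aldous_criterion M T (\<lambda>n. natural_filtration M (Xn n)) Xn"
    and e: "e > 0"
  shows "\<exists>k>0. \<forall>\<^sub>F n in sequentially. \<forall>\<tau>\<in>stopping_times M T (natural_filtration M (Xn n)).
    (\<integral>\<omega>. \<gamma> (\<tau> \<omega>, Xn n (\<tau> \<omega>) \<omega>) \<partial>M)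
      \<le> (\<integral>\<omega>. \<gamma> (grid T k (grid_index T k (\<tau> \<omega>)), X (grid T k (grid_index T k (\<tau> \<omega>))) \<omega>) \<partial>M) + e"
proof -
  let ?G = "\<lambda>n. natural_filtration M (Xn n)"
  have "0 \<le> C" using bdd[of 0 0] T by simp
  \<comment> \<open>the final error is \<open>\<eta>\<close> from the modulus of continuity plus \<open>2 * C\<close> on an event of probability
    at most \<open>3 * \<eta>\<close>\<close>
  define \<eta> where "\<eta> = e / (6 * C + 1)"
  have "(6 * C + 1) * \<eta> = e" using \<open>0 \<le> C\<close> by (simp add: \<eta>_def)
  then have \<eta>: "\<eta> > 0" "\<eta> + 2 * C * (3 * \<eta>) = e"
    using e \<open>0 \<le> C\<close> by (simp add: \<eta>_def, simp add: algebra_simps)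
  \<comment> \<open>a countable set of times that contains every grid\<close>
  define D where "D = (\<lambda>q. T * q) ` (\<rat> \<inter> {0..1})"
  have "countable D" unfolding D_def by (intro countable_image countable_Int1 countable_rat)
  moreover have "D \<subseteq> {0..T}" using T by (auto simp: D_def mult_left_le)
  ultimately obtain K where K_event: "(\<Union>t\<in>D. {\<omega>\<in>space M. K < \<bar>X t \<omega>\<bar>}) \<in> events"
    and K_prob: "prob (\<Union>t\<in>D. {\<omega>\<in>space M. K < \<bar>X t \<omega>\<bar>}) \<le> \<eta>"
    by (rule cadlag_process_bounded_in_prob[OF X _ _ \<eta>(1)])
  obtain d where d: "d > 0" and modulus: "\<And>s t x y. s \<in> {0..T} \<Longrightarrow> t \<in> {0..T} \<Longrightarrow>
      \<bar>s - t\<bar> < d \<Longrightarrow> \<bar>x - y\<bar> < d \<Longrightarrow> \<bar>y\<bar> \<le> K \<Longrightarrow> \<bar>\<gamma> (s, x) - \<gamma> (t, y)\<bar> < \<eta>"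
    using reward_modulus[OF cont \<eta>(1), of K] by metis
  let ?pairs = "\<lambda>n \<delta>. {(\<sigma>, \<nu>). \<sigma> \<in> stopping_times M T (?G n) \<and> \<nu> \<in> stopping_times M T (?G n) \<and>
    (\<forall>\<omega>\<in>space M. \<sigma> \<omega> \<le> \<nu> \<omega> \<and> \<nu> \<omega> \<le> \<sigma> \<omega> + \<delta>)}"
  let ?p = "\<lambda>n (\<sigma>, \<nu>). emeasure M {\<omega>\<in>space M. \<bar>Xn n (\<sigma> \<omega>) \<omega> - Xn n (\<nu> \<omega>) \<omega>\<bar> \<ge> d / 2}"
  \<comment> \<open>\<open>\<delta>\<close> comes from Aldous' criterion; half of it is spent on the mesh, half on the lag \<open>h\<close>\<close>
  have "((\<lambda>\<delta>. limsup (\<lambda>n. SUP sn\<in>?pairs n \<delta>. ?p n sn)) \<longlongrightarrow> 0) (at_right 0)"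
    using aldous[unfolded aldous_criterion_def, THEN spec, THEN mp, OF half_gt_zero[OF d]] .
  then have "\<forall>\<^sub>F \<delta> in at_right 0. limsup (\<lambda>n. SUP sn\<in>?pairs n \<delta>. ?p n sn) < ennreal \<eta>"
    by (rule order_tendstoD) (use \<eta> in simp)
  moreover have "\<forall>\<^sub>F \<delta> in at_right 0. 0 < \<delta> \<and> \<delta> < d"
    using d by (auto simp: eventually_at_right_field)
  ultimately have "\<forall>\<^sub>F \<delta> in at_right 0.
      limsup (\<lambda>n. SUP sn\<in>?pairs n \<delta>. ?p n sn) < ennreal \<eta> \<and> 0 < \<delta> \<and> \<delta> < d"
    by (rule eventually_conj)
  from eventually_happens'[OF _ this] obtain \<delta>
    where limsup: "limsup (\<lambda>n. SUP sn\<in>?pairs n \<delta>. ?p n sn) < ennreal \<eta>" and \<delta>: "0 < \<delta>" "\<delta> < d"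
    by auto
  obtain k :: nat where "2 * T / \<delta> < real k" using reals_Archimedean2 by blast
  moreover have "0 < 2 * T / \<delta>" using T \<delta> by simp
  ultimately have "0 < real k" "2 * T < \<delta> * real k" using \<delta> by (linarith, simp add: field_simps)
  then have k: "k > 0" "T / real k < \<delta> / 2" by (simp_all add: field_simps)
  let ?t = "grid T k"
  \<comment> \<open>small enough to be summed over the \<open>k + 1\<close> grid points\<close>
  define \<epsilon> where "\<epsilon> = min (d / 2) (\<eta> / real (k + 1))"
  have \<epsilon>: "\<epsilon> > 0" using d \<eta> by (simp add: \<epsilon>_def)
  have "\<forall>j\<in>{..k}. \<forall>\<^sub>F h in at_right 0. \<forall>\<^sub>F n in sequentially.
      outer_measure_of M {\<omega>\<in>space M. \<epsilon> < \<bar>Xn n (min T (?t j + h)) \<omega> - X (?t j) \<omega>\<bar>} \<le> ennreal \<epsilon>"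
    using grid_mem[OF T k(1)] by (intro ballI skorokhod_conv_lagged[OF conv X _ _ \<epsilon>]) auto
  then have "\<forall>\<^sub>F h in at_right 0. \<forall>j\<in>{..k}. \<forall>\<^sub>F n in sequentially.
      outer_measure_of M {\<omega>\<in>space M. \<epsilon> < \<bar>Xn n (min T (?t j + h)) \<omega> - X (?t j) \<omega>\<bar>} \<le> ennreal \<epsilon>"
    by (intro eventually_ball_finite) auto
  moreover have "\<forall>\<^sub>F h in at_right 0. 0 < h \<and> h < \<delta> / 2"
    using \<delta> by (auto simp: eventually_at_right_field intro!: exI[of _ "\<delta> / 2"])
  ultimately have "\<forall>\<^sub>F h in at_right 0. (\<forall>j\<in>{..k}. \<forall>\<^sub>F n in sequentially.
      outer_measure_of M {\<omega>\<in>space M. \<epsilon> < \<bar>Xn n (min T (?t j + h)) \<omega> - X (?t j) \<omega>\<bar>} \<le> ennreal \<epsilon>) \<and>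
      0 < h \<and> h < \<delta> / 2"
    by (rule eventually_conj)
  from eventually_happens'[OF _ this] obtain h where h: "0 < h" "h < \<delta> / 2"
    and "\<forall>j\<in>{..k}. \<forall>\<^sub>F n in sequentially.
      outer_measure_of M {\<omega>\<in>space M. \<epsilon> < \<bar>Xn n (min T (?t j + h)) \<omega> - X (?t j) \<omega>\<bar>} \<le> ennreal \<epsilon>"
    by auto
  then have "\<forall>\<^sub>F n in sequentially. \<forall>j\<in>{..k}.
      outer_measure_of M {\<omega>\<in>space M. \<epsilon> < \<bar>Xn n (min T (?t j + h)) \<omega> - X (?t j) \<omega>\<bar>} \<le> ennreal \<epsilon>"
    by (intro eventually_ball_finite) auto
  with Limsup_lessD[OF limsup] have "\<forall>\<^sub>F n in sequentially. \<forall>\<tau>\<in>stopping_times M T (?G n).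
    (\<integral>\<omega>. \<gamma> (\<tau> \<omega>, Xn n (\<tau> \<omega>) \<omega>) \<partial>M)
      \<le> (\<integral>\<omega>. \<gamma> (?t (grid_index T k (\<tau> \<omega>)), X (?t (grid_index T k (\<tau> \<omega>))) \<omega>) \<partial>M) + e"
  proof eventually_elim
    case (elim n)
    show ?case
    proof
      fix \<tau> assume \<tau>: "\<tau> \<in> stopping_times M T (?G n)"
      define N where "N \<omega> = grid_index T k (\<tau> \<omega>)" for \<omega>
      define \<nu> where "\<nu> \<omega> = min T (?t (N \<omega>) + h)" for \<omega>
      note N = natural_stopping_time_at_grid[OF \<tau> T k(1), folded N_def]
      have t_N: "\<tau> \<omega> \<le> ?t (N \<omega>)" "?t (N \<omega>) < \<tau> \<omega> + \<delta> / 2" "?t (N \<omega>) \<in> {0..T}" if "\<omega> \<in> space M" for \<omega>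
      proof -
        have "0 \<le> \<tau> \<omega>" using N(3)[OF that] by simp
        show "\<tau> \<omega> \<le> ?t (N \<omega>)" unfolding N_def by (rule le_grid_index[OF T k(1)])
        show "?t (N \<omega>) < \<tau> \<omega> + \<delta> / 2"
          using grid_index_less[OF T k(1) \<open>0 \<le> \<tau> \<omega>\<close>] k(2) unfolding N_def by linarith
        show "?t (N \<omega>) \<in> {0..T}" using grid_mem[OF T k(1) N(2)[OF that]] .
      qed
      have subG: "subalgebra M (?G n t)" if "t \<le> T" for t
        using subalgebra_natural_filtration[OF Xn that] .
      have \<tau>_meas: "\<tau> \<in> borel_measurable M" by (rule borel_measurable_stopping_times[OF subG \<tau>])
      have "stopping_time (?G n) \<nu>"
        unfolding \<nu>_def
        by (rule stopping_time_grid[where \<Omega> = "space M" and k = k])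
          (use N h mono_grid[OF T k(1)] in \<open>auto intro: natural_filtration_mono[THEN subsetD]\<close>)
      then have \<nu>: "\<nu> \<in> stopping_times M T (?G n)"
        using t_N(3) h T by (auto simp: stopping_times_def \<nu>_def)
      have \<nu>_meas: "\<nu> \<in> borel_measurable M" by (rule borel_measurable_stopping_times[OF subG \<nu>])
      have \<nu>_range: "\<nu> \<omega> \<in> {0..T}" if "\<omega> \<in> space M" for \<omega>
        using \<nu> that by (auto simp: stopping_times_def)
      have [measurable]: "(\<lambda>\<omega>. Xn n (\<tau> \<omega>) \<omega>) \<in> borel_measurable M" "(\<lambda>\<omega>. Xn n (\<nu> \<omega>) \<omega>) \<in> borel_measurable M"
        using borel_measurable_cadlag_process_at[OF Xn less_imp_le[OF T]] \<tau>_meas \<nu>_meas N(3) \<nu>_range by auto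
      define B1 where "B1 = (\<Union>t\<in>D. {\<omega>\<in>space M. K < \<bar>X t \<omega>\<bar>})"
      define B2 where "B2 = {\<omega>\<in>space M. \<bar>Xn n (\<tau> \<omega>) \<omega> - Xn n (\<nu> \<omega>) \<omega>\<bar> \<ge> d / 2}"
      define B3 where "B3 j = {\<omega>\<in>space M. \<epsilon> < \<bar>Xn n (min T (?t j + h)) \<omega> - X (?t j) \<omega>\<bar>}" for j
      define B where "B = B1 \<union> B2 \<union> (\<Union>j\<le>k. B3 j)"
      have B1: "B1 \<in> events" "prob B1 \<le> \<eta>" unfolding B1_def by (rule K_event, rule K_prob)
      have B2_event: "B2 \<in> events" unfolding B2_def by measurable
      have "(\<tau>, \<nu>) \<in> ?pairs n \<delta>"
        using \<tau> \<nu> t_N h N(3) by (fastforce simp: \<nu>_def)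
      then have "?p n (\<tau>, \<nu>) \<le> (SUP sn\<in>?pairs n \<delta>. ?p n sn)" by (rule SUP_upper)
      also note elim(1)
      finally have "emeasure M B2 < ennreal \<eta>" unfolding B2_def by (simp only: prod.case)
      then have B2: "prob B2 \<le> \<eta>" using \<eta> by (simp add: emeasure_eq_measure ennreal_less_iff)
      have B3_event: "B3 j \<in> events" if "j \<le> k" for j
      proof -
        have "?t j \<in> {0..T}" using grid_mem[OF T k(1) that] .
        then have [measurable]: "Xn n (min T (?t j + h)) \<in> borel_measurable M" "X (?t j) \<in> borel_measurable M"
          using X Xn[of n] h T by (auto simp: cadlag_process_def)
        show ?thesis unfolding B3_def by measurable
      qed
      have B3: "prob (B3 j) \<le> \<eta> / real (k + 1)" if "j \<le> k" for j
      proof -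
        have "outer_measure_of M (B3 j) \<le> ennreal \<epsilon>" using elim(2) that unfolding B3_def by blast
        then have "prob (B3 j) \<le> \<epsilon>" using \<epsilon> B3_event[OF that] by (simp add: emeasure_eq_measure)
        then show ?thesis by (simp add: \<epsilon>_def)
      qed
      have "prob (\<Union>j\<le>k. B3 j) \<le> (\<Sum>j\<le>k. prob (B3 j))"
        using B3_event by (intro finite_measure_subadditive_finite) auto
      also have "\<dots> \<le> (\<Sum>j\<le>k. \<eta> / real (k + 1))" using B3 by (intro sum_mono) auto
      also have "\<dots> = \<eta>" by simp
      finally have B3_Un: "prob (\<Union>j\<le>k. B3 j) \<le> \<eta>" .
      have B3_Un_event: "(\<Union>j\<le>k. B3 j) \<in> events" using B3_event by auto
      have B_event: "B \<in> events" unfolding B_def using B1 B2_event B3_Un_event by auto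
      have "prob B \<le> prob (B1 \<union> B2) + prob (\<Union>j\<le>k. B3 j)"
        unfolding B_def using B1 B2_event B3_Un_event by (intro measure_Un_le) auto
      also have "prob (B1 \<union> B2) \<le> prob B1 + prob B2"
        using B1 B2_event by (intro measure_Un_le) auto
      finally have B: "prob B \<le> 3 * \<eta>" using B1 B2 B3_Un by linarith
      define Z where "Z \<omega> = \<gamma> (?t (N \<omega>), X (?t (N \<omega>)) \<omega>)" for \<omega>
      have pointwise: "\<gamma> (\<tau> \<omega>, Xn n (\<tau> \<omega>) \<omega>) \<le> Z \<omega> + \<eta> + 2 * C * indicator B \<omega>"
        if \<omega>: "\<omega> \<in> space M" for \<omega>
      proof (cases "\<omega> \<in> B")
        case True
        have "\<bar>\<gamma> (\<tau> \<omega>, Xn n (\<tau> \<omega>) \<omega>)\<bar> \<le> C" "\<bar>Z \<omega>\<bar> \<le> C"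
          unfolding Z_def using N(3)[OF \<omega>] t_N(3)[OF \<omega>] by (auto intro!: bdd)
        with True \<eta> show ?thesis by simp
      next
        case False
        have "?t (N \<omega>) = T * (real (N \<omega>) / real k)" by (simp add: grid_def)
        moreover have "real (N \<omega>) / real k \<in> \<rat> \<inter> {0..1}" using N(2)[OF \<omega>] k by (auto simp: field_simps)
        ultimately have "?t (N \<omega>) \<in> D" unfolding D_def by (rule image_eqI)
        with False \<omega> have "\<bar>X (?t (N \<omega>)) \<omega>\<bar> \<le> K" by (auto simp: B_def B1_def not_less)
        moreover have "\<bar>Xn n (\<tau> \<omega>) \<omega> - X (?t (N \<omega>)) \<omega>\<bar> < d"
        proof -
          have "\<bar>Xn n (\<tau> \<omega>) \<omega> - Xn n (\<nu> \<omega>) \<omega>\<bar> < d / 2" using False \<omega> by (auto simp: B_def B2_def)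
          moreover have "\<bar>Xn n (\<nu> \<omega>) \<omega> - X (?t (N \<omega>)) \<omega>\<bar> \<le> \<epsilon>"
            using False \<omega> N(2)[OF \<omega>] by (auto simp: B_def B3_def \<nu>_def not_less)
          ultimately show ?thesis unfolding \<epsilon>_def by linarith
        qed
        moreover have "\<bar>\<tau> \<omega> - ?t (N \<omega>)\<bar> < d" using t_N[OF \<omega>] \<delta> by auto
        ultimately have "\<bar>\<gamma> (\<tau> \<omega>, Xn n (\<tau> \<omega>) \<omega>) - Z \<omega>\<bar> < \<eta>"
          unfolding Z_def using N(3)[OF \<omega>] t_N(3)[OF \<omega>] by (intro modulus) auto
        with False show ?thesis by simp
      qed
      have Z_int: "integrable M Z"
        unfolding Z_def
        by (rule integrable_reward_at[OF cont less_imp_le[OF T] bdd X])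
          (use t_N(3) borel_measurable_grid_index[OF \<tau>_meas] in \<open>auto simp: N_def\<close>)
      have B_int: "integrable M (\<lambda>\<omega>. 2 * C * indicator B \<omega> :: real)"
        using B_event by (intro integrable_mult_right integrable_const_bound[where B = 1]) auto
      have "(\<integral>\<omega>. \<gamma> (\<tau> \<omega>, Xn n (\<tau> \<omega>) \<omega>) \<partial>M) \<le> (\<integral>\<omega>. Z \<omega> + \<eta> + 2 * C * indicator B \<omega> \<partial>M)"
        using Z_int B_int
        by (intro integral_mono pointwise integrable_reward_at[OF cont less_imp_le[OF T] bdd Xn \<tau>_meas] N(3)
            Bochner_Integration.integrable_add) auto
      also have "\<dots> = (\<integral>\<omega>. Z \<omega> \<partial>M) + \<eta> + 2 * C * prob B"
        using Z_int B_int B_event by (simp add: prob_space)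
      also have "2 * C * prob B \<le> 2 * C * (3 * \<eta>)" using B \<open>0 \<le> C\<close> by (intro mult_left_mono) auto
      finally have "(\<integral>\<omega>. \<gamma> (\<tau> \<omega>, Xn n (\<tau> \<omega>) \<omega>) \<partial>M) \<le> (\<integral>\<omega>. Z \<omega> \<partial>M) + e" using \<eta>(2) by linarith
      then show "(\<integral>\<omega>. \<gamma> (\<tau> \<omega>, Xn n (\<tau> \<omega>) \<omega>) \<partial>M)
          \<le> (\<integral>\<omega>. \<gamma> (?t (grid_index T k (\<tau> \<omega>)), X (?t (grid_index T k (\<tau> \<omega>))) \<omega>) \<partial>M) + e"
        by (simp add: Z_def N_def)
    qed
  qed
  with k(1) show ?thesis by blast
qed

theorem theorem13:
  fixes M :: "'a measure" and T :: real
    and X :: "real \<Rightarrow> 'a \<Rightarrow> real" and Xn :: "nat \<Rightarrow> real \<Rightarrow> 'a \<Rightarrow> real"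
    and \<gamma> :: "real \<times> real \<Rightarrow> real"
  assumes "prob_space M"
    and "T > 0"
    and "\<And>n. cadlag_process M T (Xn n)"
    and "cadlag_process M T X"
    and "continuous_on ({0..T} \<times> UNIV) \<gamma>"
    and "bounded (\<gamma> ` ({0..T} \<times> UNIV))"
    and "skorokhod_conv_in_prob M T Xn X"
    and "aldous_criterion M T (\<lambda>n. natural_filtration M (Xn n)) Xn"
    and "weak_filtration_conv M T (\<lambda>n. natural_filtration M (Xn n)) (right_cont_filtration M T X)"
  shows "limsup (\<lambda>n. ereal (optimal_value M T (natural_filtration M (Xn n)) \<gamma> (Xn n)))
           \<le> ereal (optimal_value M T (right_cont_filtration M T X) \<gamma> X)"
proof (rule ereal_le_epsilon2)
  fix e :: real assume "0 < e"
  interpret prob_space M by fact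
  let ?V = "optimal_value M T (right_cont_filtration M T X) \<gamma> X"
  obtain C where "\<forall>y\<in>\<gamma> ` ({0..T} \<times> UNIV). norm y \<le> C"
    using assms(6) unfolding bounded_iff by blast
  then have bdd: "\<bar>\<gamma> (t, x)\<bar> \<le> C" if "t \<in> {0..T}" for t x using that by auto
  have "e / 2 > 0" using \<open>0 < e\<close> by simp
  obtain k where "k > 0" and grid: "\<forall>\<^sub>F n in sequentially.
      \<forall>\<tau>\<in>stopping_times M T (natural_filtration M (Xn n)). (\<integral>\<omega>. \<gamma> (\<tau> \<omega>, Xn n (\<tau> \<omega>) \<omega>) \<partial>M)
        \<le> (\<integral>\<omega>. \<gamma> (grid T k (grid_index T k (\<tau> \<omega>)), X (grid T k (grid_index T k (\<tau> \<omega>))) \<omega>) \<partial>M) + e / 2"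
    using stopped_reward_le_grid[OF assms(2,4,3,5) bdd assms(7,8) \<open>e / 2 > 0\<close>] by blast
  have "\<forall>\<^sub>F n in sequentially. \<forall>\<tau>\<in>stopping_times M T (natural_filtration M (Xn n)).
    (\<integral>\<omega>. \<gamma> (grid T k (grid_index T k (\<tau> \<omega>)), X (grid T k (grid_index T k (\<tau> \<omega>))) \<omega>) \<partial>M) \<le> ?V + e / 2"
    using discrete_optimal_value_bound[OF assms(2) \<open>k > 0\<close> assms(4,3,5) bdd assms(9) \<open>e / 2 > 0\<close>] .
  with grid have "\<forall>\<^sub>F n in sequentially.
      ereal (optimal_value M T (natural_filtration M (Xn n)) \<gamma> (Xn n)) \<le> ereal (?V + e)"
  proof eventually_elim
    case (elim n)
    have "(\<lambda>_. 0) \<in> stopping_times M T (natural_filtration M (Xn n))"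
      using assms(2) by (auto simp: stopping_times_def stopping_time_const)
    then have "optimal_value M T (natural_filtration M (Xn n)) \<gamma> (Xn n) \<le> ?V + e"
      unfolding optimal_value_def[of M T "natural_filtration M (Xn n)"]
      using elim by (intro cSUP_least) (auto, fastforce)
    then show ?case by simp
  qed
  then show "limsup (\<lambda>n. ereal (optimal_value M T (natural_filtration M (Xn n)) \<gamma> (Xn n))) \<le> ereal ?V + ereal e"
    by (intro Limsup_bounded) simp
qed

end
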